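(* Let $K\ne0$, $R>0$ (with $R<\pi/(2\sqrt K)$ if $K>0$), and let $F:\mathcal M_K\to\mathbb R$ be an $L$-smooth and $\mu$-strongly g-convex function on $\mathcal B_R:=\exp_{x_0}(\bar B(0,R))\subset\mathcal M_K$, with $\mu>0$. Assume $F$ is twice differentiable with continuous Hessian. Then the condition number $L/\mu$ of $F$ on $\mathcal B_R$ is at least the condition number of the function $x\mapsto\frac12 d(x,x_0)^2$ on $\mathcal B_R$.
   Context: $\mathcal M_K$ denotes any manifold that is a subset of an $n$-dimensional complete simply connected Riemannian manifold of constant sectional curvature $K$ (hyperbolic space if $K<0$, sphere if $K>0$), with the inherited metric and containing $\mathcal B_R$; $\bar B(0,R)\subset T_{x_0}\mathcal M_K$ is the closed ball, and $d$ the Riemannian distance. $F$ is $L$-smooth on $\mathcal B_R$ if $F(y)\le F(x)+\langle\nabla F(x),\exp_x^{-1}(y)\rangle+\frac L2 d(x,y)^2$, and $\mu$-strongly g-convex on $\mathcal B_R$ if $F(y)\ge F(x)+\langle\nabla F(x),\exp_x^{-1}(y)\rangle+\frac\mu2 d(x,y)^2$, for all $x,y\in\mathcal B_R$. The condition number of a function on $\mathcal B_R$ is $L/\mu$; for $\frac12d(\cdot,x_0)^2$ it is the ratio of its smallest smoothness constant to its largest strong g-convexity constant on $\mathcal B_R$. *)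

theory Defs
  imports "HOL-Analysis.Analysis"
begin

text \<open>
  The \<open>n\<close>-dimensional space form of curvature \<open>K \<noteq> 0\<close>, with \<open>n = DIM('a)\<close>, is realised inside
  \<open>'a \<times> real\<close>: for \<open>K > 0\<close> as the sphere of radius \<open>1 / sqrt K\<close> in Euclidean space, for \<open>K < 0\<close>
  as the upper sheet of the hyperboloid \<open>\<langle>x, x\<rangle> = 1 / K\<close> in Minkowski space.  In both cases the
  Riemannian metric is the restriction of the ambient form to the tangent spaces, where it is
  positive definite.
\<close>

definition form :: "real \<Rightarrow> 'a::euclidean_space \<times> real \<Rightarrow> 'a \<times> real \<Rightarrow> real" where
  "form K x y = fst x \<bullet> fst y + sgn K * (snd x * snd y)"

definition space_form :: "real \<Rightarrow> ('a::euclidean_space \<times> real) set" where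
  "space_form K = {x. form K x x = 1 / K \<and> (K < 0 \<longrightarrow> snd x > 0)}"

definition tangent :: "real \<Rightarrow> 'a::euclidean_space \<times> real \<Rightarrow> ('a \<times> real) set" where
  "tangent K x = {v. form K x v = 0}"

definition tnorm :: "real \<Rightarrow> 'a::euclidean_space \<times> real \<Rightarrow> real" where
  "tnorm K v = sqrt (form K v v)"

text \<open>
  The orthogonal projection onto the tangent space at a point \<open>x\<close> of the space form; the factor
  \<open>K\<close> is \<open>1 / form K x x\<close>.
\<close>

definition tproj :: "real \<Rightarrow> 'a::euclidean_space \<times> real \<Rightarrow> 'a \<times> real \<Rightarrow> 'a \<times> real" where
  "tproj K x w = w - (K * form K x w) *\<^sub>R x"

text \<open>
  The Levi-Civita connection of the induced metric is the tangential projection of the ambient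
  derivative, so geodesics are the curves whose ambient acceleration is normal.
\<close>

definition geodesic :: "real \<Rightarrow> (real \<Rightarrow> 'a::euclidean_space \<times> real) \<Rightarrow> bool" where
  "geodesic K \<gamma> \<longleftrightarrow> range \<gamma> \<subseteq> space_form K \<and>
     (\<exists>\<gamma>' \<gamma>''. \<forall>t. (\<gamma> has_vector_derivative \<gamma>' t) (at t) \<and>
                 (\<gamma>' has_vector_derivative \<gamma>'' t) (at t) \<and>
                 tproj K (\<gamma> t) (\<gamma>'' t) = 0)"

definition rexp :: "real \<Rightarrow> 'a::euclidean_space \<times> real \<Rightarrow> 'a \<times> real \<Rightarrow> 'a \<times> real" where
  "rexp K x v =
     (THE y. \<exists>\<gamma>. geodesic K \<gamma> \<and> \<gamma> 0 = x \<and> (\<gamma> has_vector_derivative v) (at 0) \<and> \<gamma> 1 = y)"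

text \<open>
  The Riemannian distance is the infimum of the lengths of piecewise \<open>C\<^sup>1\<close> curves.  The library's
  notion \<^const>\<open>valid_path\<close> allows the speed to be unbounded near the finitely many break points,
  and \<^const>\<open>integral\<close> returns \<open>0\<close> on non-integrable functions; hence the integrability condition,
  which excludes exactly the curves of infinite length.
\<close>

definition speed :: "real \<Rightarrow> (real \<Rightarrow> 'a::euclidean_space \<times> real) \<Rightarrow> real \<Rightarrow> real" where
  "speed K \<gamma> t = tnorm K (vector_derivative \<gamma> (at t))"

definition rdist :: "real \<Rightarrow> 'a::euclidean_space \<times> real \<Rightarrow> 'a \<times> real \<Rightarrow> real" where
  "rdist K x y =
     Inf {integral {0..1} (speed K \<gamma>) |\<gamma>. valid_path \<gamma> \<and> speed K \<gamma> integrable_on {0..1} \<and>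
            path_image \<gamma> \<subseteq> space_form K \<and> pathstart \<gamma> = x \<and> pathfinish \<gamma> = y}"

text \<open>
  The branch of the inverse of \<^term>\<open>rexp K x\<close> given by minimizing geodesics; on the sphere it is
  well defined at non-antipodal points.
\<close>

definition rlog :: "real \<Rightarrow> 'a::euclidean_space \<times> real \<Rightarrow> 'a \<times> real \<Rightarrow> 'a \<times> real" where
  "rlog K x y = (THE v. v \<in> tangent K x \<and> rexp K x v = y \<and> tnorm K v = rdist K x y)"

definition geo_ball :: "real \<Rightarrow> 'a::euclidean_space \<times> real \<Rightarrow> real \<Rightarrow> ('a \<times> real) set" where
  "geo_ball K x0 R = rexp K x0 ` {v \<in> tangent K x0. tnorm K v \<le> R}"

text \<open>
  A subset of \<open>'a \<times> real\<close> that is a \<open>DIM('a)\<close>-dimensional manifold, possibly with boundary (so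
  that a closed geodesic ball qualifies, as does every relatively open set of the space form).
\<close>

definition manifold_subset :: "('a::euclidean_space \<times> real) set \<Rightarrow> bool" where
  "manifold_subset M \<longleftrightarrow>
     (\<forall>p\<in>M. \<exists>U V. \<exists>b\<in>Basis::'a set. p \<in> U \<and> openin (top_of_set M) U \<and>
        openin (top_of_set {v. 0 \<le> v \<bullet> b}) V \<and> U homeomorphic V)"

text \<open>
  Derivatives of a function on \<open>M\<close> are taken within \<open>M\<close>: an ambient linear map \<open>D\<close> that
  approximates the function along \<open>M\<close> is determined only on the tangent space, and only its
  restriction to tangent vectors is used.
\<close>

definition is_gradient ::
  "real \<Rightarrow> ('a::euclidean_space \<times> real) set \<Rightarrow> ('a \<times> real \<Rightarrow> real) \<Rightarrow> 'a \<times> real \<Rightarrow> 'a \<times> real \<Rightarrow> bool"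
  where
  "is_gradient K M F x g \<longleftrightarrow> g \<in> tangent K x \<and>
     (\<exists>D. (F has_derivative D) (at x within M) \<and> (\<forall>v\<in>tangent K x. D v = form K g v))"

definition rgrad ::
  "real \<Rightarrow> ('a::euclidean_space \<times> real) set \<Rightarrow> ('a \<times> real \<Rightarrow> real) \<Rightarrow> 'a \<times> real \<Rightarrow> 'a \<times> real"
  where
  "rgrad K M F x = (THE g. is_gradient K M F x g)"

text \<open>
  \<open>A v\<close> is the covariant derivative at \<open>x\<close> of the tangent field \<open>G\<close> in the direction \<open>v\<close>.  For
  \<open>G\<close> the gradient field of \<open>F\<close>, \<open>A\<close> is the Hessian of \<open>F\<close> at \<open>x\<close> as an endomorphism.
\<close>

definition is_covariant_derivative ::
  "real \<Rightarrow> ('a::euclidean_space \<times> real) set \<Rightarrow> ('a \<times> real \<Rightarrow> 'a \<times> real) \<Rightarrow> 'a \<times> real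
     \<Rightarrow> ('a \<times> real \<Rightarrow> 'a \<times> real) \<Rightarrow> bool"
  where
  "is_covariant_derivative K M G x A \<longleftrightarrow>
     (\<exists>D. (G has_derivative D) (at x within M) \<and> (\<forall>v\<in>tangent K x. A v = tproj K x (D v)))"

text \<open>
  Continuity of the Hessian \<open>H\<close> as a tensor field is tested on the tangent fields
  \<open>x \<mapsto> tproj K x w\<close> for constant \<open>w\<close>, which span every tangent space.
\<close>

definition twice_differentiable_continuous_hessian ::
  "real \<Rightarrow> ('a::euclidean_space \<times> real) set \<Rightarrow> ('a \<times> real \<Rightarrow> real) \<Rightarrow> bool"
  where
  "twice_differentiable_continuous_hessian K M F \<longleftrightarrow>
     (\<exists>G H. (\<forall>x\<in>M. is_gradient K M F x (G x)) \<and>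
            (\<forall>x\<in>M. is_covariant_derivative K M G x (H x)) \<and>
            (\<forall>w. continuous_on M (\<lambda>x. H x (tproj K x w))))"

definition smooth_fun_on ::
  "real \<Rightarrow> ('a::euclidean_space \<times> real) set \<Rightarrow> ('a \<times> real) set \<Rightarrow> ('a \<times> real \<Rightarrow> real) \<Rightarrow> real \<Rightarrow> bool"
  where
  "smooth_fun_on K M B F L \<longleftrightarrow>
     (\<forall>x\<in>B. \<forall>y\<in>B. F y \<le> F x + form K (rgrad K M F x) (rlog K x y) + L / 2 * (rdist K x y)\<^sup>2)"

definition strongly_gconvex_on ::
  "real \<Rightarrow> ('a::euclidean_space \<times> real) set \<Rightarrow> ('a \<times> real) set \<Rightarrow> ('a \<times> real \<Rightarrow> real) \<Rightarrow> real \<Rightarrow> bool"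
  where
  "strongly_gconvex_on K M B F \<mu> \<longleftrightarrow>
     (\<forall>x\<in>B. \<forall>y\<in>B. F y \<ge> F x + form K (rgrad K M F x) (rlog K x y) + \<mu> / 2 * (rdist K x y)\<^sup>2)"

definition condition_number ::
  "real \<Rightarrow> ('a::euclidean_space \<times> real) set \<Rightarrow> ('a \<times> real) set \<Rightarrow> ('a \<times> real \<Rightarrow> real) \<Rightarrow> real"
  where
  "condition_number K M B f =
     (LEAST L. smooth_fun_on K M B f L) / (GREATEST \<mu>. strongly_gconvex_on K M B f \<mu>)"

end

theory Submission
  imports Defs
begin

text \<open>
  Add up the smoothness (or convexity) inequality of \<open>F\<close> over the edges of a regular \<open>N\<close>-gon inscribed in a circle of radius \<open>R\<close> about
  \<open>x0\<close>, in both directions: the values of \<open>F\<close> cancel, and at each vertex the two initial velocities add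
  up to a multiple of the velocity towards \<open>x0\<close>.  So the sum of the radial derivatives of \<open>F\<close> is bounded
  on one side by the geodesic curvature of the circle, and on the other side by the inequalities between
  the vertices and \<open>x0\<close>, in which the gradient at \<open>x0\<close> cancels by symmetry.  As \<open>N\<close> tends to infinity
  this gives \<open>\<mu> \<rho> \<le> L\<close> and \<open>\<mu> \<le> L \<rho>\<close>, where \<open>\<rho> = R / tan R\<close> for \<open>K = 1\<close> and \<open>\<rho> = R / tanh R\<close>
  for \<open>K = - 1\<close>.  The second derivative of half the squared distance along unit speed geodesics lies
  between \<open>1\<close> and \<open>\<rho>\<close>, so its condition number is \<open>max \<rho> (1 / \<rho>)\<close>.  In dimension one there is no circle,
  but there every geodesic is radial and the condition number is \<open>1\<close>.
\<close>

section \<open>Trigonometry of constant curvature\<close>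

text \<open>Smoothness and convexity are inequalities between two points, so the Hessian along the
  circle is sampled by finite sums of them. The spokes confine the average radial derivative to an
  interval whose ends are proportional to \<mu> and L, the sides confine it to a second one, and the
  two must meet. Only upper bounds are summed: convexity of F is smoothness of - F with the constant
  - \<mu>. The same inequalities, applied to half the squared distance itself, show in dimension at
  least two that its constants are extremal. The other obstacle is that distance, exponential map
  and logarithm are given by an infimum over curves and by definite descriptions. They are first
  replaced by the closed forms \<open>sdist\<close>, \<open>geod\<close> and \<open>slog\<close>,
  which are valid on the ball because it contains no antipodal pair.\<close>

text \<open>Both \<open>cs K\<close> and \<open>sn K\<close> solve \<open>f'' = - K f\<close>; they allow a common treatment of the two signs of \<open>K\<close>.\<close>

definition cs :: "real \<Rightarrow> real \<Rightarrow> real" where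
  "cs K t = (if K > 0 then cos (sqrt K * t) else cosh (sqrt (- K) * t))"

definition sn :: "real \<Rightarrow> real \<Rightarrow> real" where
  "sn K t = (if K > 0 then sin (sqrt K * t) / sqrt K else sinh (sqrt (- K) * t) / sqrt (- K))"

definition acs :: "real \<Rightarrow> real \<Rightarrow> real" where
  "acs K s = (if K > 0 then arccos s / sqrt K else arcosh s / sqrt (- K))"

definition cs_range :: "real \<Rightarrow> real set" where
  "cs_range K = (if K > 0 then {-1..1} else {1..})"

lemma curvature_cases:
  fixes K :: real
  assumes "K \<noteq> 0"
  obtains (pos) k where "k > 0" "K = k\<^sup>2" | (neg) k where "k > 0" "K = - (k\<^sup>2)"
proof (cases "K > 0")
  case True
  then show ?thesis using pos[of "sqrt K"] by simp
next
  case False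
  then show ?thesis using neg[of "sqrt (- K)"] assms by simp
qed

lemma curvature_sphere:
  assumes "k > 0"
  shows "cs (k\<^sup>2) t = cos (k * t)" "sn (k\<^sup>2) t = sin (k * t) / k" "acs (k\<^sup>2) s = arccos s / k"
    "cs_range (k\<^sup>2) = {-1..1}"
  using assms by (simp_all add: cs_def sn_def acs_def cs_range_def)

lemma curvature_hyperbolic:
  assumes "k > 0"
  shows "cs (- (k\<^sup>2)) t = cosh (k * t)" "sn (- (k\<^sup>2)) t = sinh (k * t) / k"
    "acs (- (k\<^sup>2)) s = arcosh s / k" "cs_range (- (k\<^sup>2)) = {1..}"
  using assms by (simp_all add: cs_def sn_def acs_def cs_range_def)

text \<open>Each rule occurs also with \<open>k * k\<close> for the square, because goals rewritten
  with \<open>power2_eq_square\<close> have lost the first pattern.\<close>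

lemmas curvature_simps = curvature_sphere curvature_hyperbolic
  curvature_sphere[unfolded power2_eq_square] curvature_hyperbolic[unfolded power2_eq_square]

lemma cs_0 [simp]: "cs K 0 = 1" and sn_0 [simp]: "sn K 0 = 0"
  by (auto simp: cs_def sn_def)

lemma cs_minus [simp]: "cs K (- t) = cs K t" and sn_minus [simp]: "sn K (- t) = - sn K t"
  by (auto simp: cs_def sn_def)

lemma has_real_derivative_cs [derivative_intros]:
  assumes "K \<noteq> 0" "(f has_real_derivative f') (at x within S)"
  shows "((\<lambda>x. cs K (f x)) has_real_derivative - K * sn K (f x) * f') (at x within S)"
  using assms(1)
proof (cases rule: curvature_cases)
  case (pos k)
  have "- sin (k * f x) * (k * f') = - K * sn K (f x) * f'"
    using pos by (simp add: curvature_simps power2_eq_square)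
  moreover have "((\<lambda>x. cos (k * f x)) has_real_derivative - sin (k * f x) * (k * f')) (at x within S)"
    by (auto intro!: derivative_eq_intros assms(2))
  ultimately show ?thesis using pos by (simp add: curvature_simps)
next
  case (neg k)
  have "sinh (k * f x) * (k * f') = - K * sn K (f x) * f'"
    using neg by (simp add: curvature_simps power2_eq_square)
  moreover have "((\<lambda>x. cosh (k * f x)) has_real_derivative sinh (k * f x) * (k * f')) (at x within S)"
    by (auto intro!: derivative_eq_intros assms(2))
  ultimately show ?thesis using neg by (simp add: curvature_simps)
qed

lemma has_real_derivative_sn [derivative_intros]:
  assumes "K \<noteq> 0" "(f has_real_derivative f') (at x within S)"
  shows "((\<lambda>x. sn K (f x)) has_real_derivative cs K (f x) * f') (at x within S)"
  using assms(1)
proof (cases rule: curvature_cases)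
  case (pos k)
  have "((\<lambda>x. sin (k * f x) / k) has_real_derivative (cos (k * f x) * (k * f')) / k) (at x within S)"
    by (intro DERIV_cdivide) (auto intro!: derivative_eq_intros assms(2))
  then show ?thesis using pos by (simp add: curvature_simps)
next
  case (neg k)
  have "((\<lambda>x. sinh (k * f x) / k) has_real_derivative (cosh (k * f x) * (k * f')) / k) (at x within S)"
    by (intro DERIV_cdivide) (auto intro!: derivative_eq_intros assms(2))
  then show ?thesis using neg by (simp add: curvature_simps)
qed

lemma cs_sn_identity:
  assumes "K \<noteq> 0" shows "(cs K t)\<^sup>2 + K * (sn K t)\<^sup>2 = 1"
  using assms
proof (cases rule: curvature_cases)
  case (neg k)
  then show ?thesis by (simp add: curvature_simps power_divide cosh_square_eq)
qed (simp add: curvature_simps power_divide)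

lemma cs_add:
  assumes "K \<noteq> 0" shows "cs K (s + t) = cs K s * cs K t - K * sn K s * sn K t"
  using assms
  by (cases rule: curvature_cases)
    (simp_all add: curvature_simps distrib_left cos_add cosh_add power2_eq_square)

lemma sn_add:
  assumes "K \<noteq> 0" shows "sn K (s + t) = sn K s * cs K t + cs K s * sn K t"
  using assms
  by (cases rule: curvature_cases)
    (simp_all add: curvature_simps distrib_left sin_add sinh_add add_divide_distrib)

lemma cs_diff: "K \<noteq> 0 \<Longrightarrow> cs K (s - t) = cs K s * cs K t + K * sn K s * sn K t"
  using cs_add[of K s "-t"] by simp

lemma sn_diff: "K \<noteq> 0 \<Longrightarrow> sn K (s - t) = sn K s * cs K t - cs K s * sn K t"
  using sn_add[of K s "-t"] by simp

lemma sn_pos: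
  assumes "K \<noteq> 0" "t > 0" "K > 0 \<Longrightarrow> t < pi / sqrt K"
  shows "sn K t > 0"
  using assms(1)
proof (cases rule: curvature_cases)
  case (pos k)
  then have "k * t < pi" using assms by (simp add: field_simps)
  then show ?thesis using pos assms by (simp add: curvature_simps sin_gt_zero)
next
  case (neg k)
  then show ?thesis using assms by (simp add: curvature_simps)
qed

text \<open>The factor K reverses the inequality for K < 0, so that one statement covers cos at most
  1 and cosh at least 1. Later comparisons use the same device.\<close>

lemma cs_le_1: "K * (1 - cs K t) \<ge> 0"
proof (cases "K > 0")
  case False
  then show ?thesis using cosh_real_ge_1[of "sqrt (-K) * t"]
    by (simp add: cs_def mult_nonpos_nonpos)
qed (simp add: cs_def)

lemma cs_pos:
  assumes "K \<noteq> 0" "t \<ge> 0" "K > 0 \<Longrightarrow> t < pi / (2 * sqrt K)"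
  shows "cs K t > 0"
  using assms(1)
proof (cases rule: curvature_cases)
  case (pos k)
  then have "k * t < pi / 2" using assms by (simp add: field_simps)
  moreover have "k * t \<ge> 0" using pos assms by simp
  ultimately show ?thesis using pos cos_gt_zero_pi[of "k * t"] pi_gt_zero
    by (simp add: curvature_simps del: pi_gt_zero)
next
  case (neg k)
  then show ?thesis by (simp add: curvature_simps)
qed

lemma acs_cs:
  assumes "K \<noteq> 0" "t \<ge> 0" "K > 0 \<Longrightarrow> t \<le> pi / sqrt K"
  shows "acs K (cs K t) = t"
  using assms(1)
proof (cases rule: curvature_cases)
  case (pos k)
  then have "k * t \<le> pi" using assms by (simp add: field_simps)
  then show ?thesis using pos assms by (simp add: curvature_simps arccos_cos)
next
  case (neg k)
  then show ?thesis using assms by (simp add: curvature_simps arcosh_cosh_real)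
qed

lemma acs_1 [simp]: "acs K 1 = 0"
  by (simp add: acs_def)

lemma
  assumes "K \<noteq> 0" "s \<in> cs_range K"
  shows cs_acs: "cs K (acs K s) = s"
    and acs_nonneg: "acs K s \<ge> 0"
    and acs_le: "K > 0 \<Longrightarrow> acs K s \<le> pi / sqrt K"
  using assms
  by (auto simp: cs_def acs_def cs_range_def cos_arccos arccos_lbound arccos_ubound divide_right_mono split: if_splits)

lemma acs_less:
  assumes "K > 0" "s \<in> cs_range K" "s \<noteq> -1"
  shows "acs K s < pi / sqrt K"
proof -
  have "acs K s \<noteq> pi / sqrt K"
  proof
    assume "acs K s = pi / sqrt K"
    then have "cs K (pi / sqrt K) = s" using cs_acs[of K s] assms by simp
    then show False using assms by (simp add: cs_def)
  qed
  then show ?thesis using acs_le[of K s] assms by simp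
qed

lemma cs_antimono:
  assumes "K \<noteq> 0" "s \<ge> 0" "t \<ge> 0" "K > 0 \<Longrightarrow> s \<le> pi / sqrt K" "K > 0 \<Longrightarrow> t \<le> pi / sqrt K"
  shows "K * (cs K s - cs K t) \<ge> 0 \<longleftrightarrow> s \<le> t"
  using assms(1)
proof (cases rule: curvature_cases)
  case (pos k)
  then have "k * s \<le> pi" "k * t \<le> pi" using assms by (simp_all add: field_simps)
  then show ?thesis using pos assms
    by (simp add: curvature_simps zero_le_mult_iff cos_mono_le_eq)
next
  case (neg k)
  then show ?thesis using assms
    by (simp add: curvature_simps mult_le_0_iff cosh_real_nonneg_le_iff)
qed

lemma has_real_derivative_acs:
  assumes "K \<noteq> 0" "s \<in> cs_range K" "s \<noteq> 1" "s \<noteq> -1"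
  shows "(acs K has_real_derivative - 1 / (K * sn K (acs K s))) (at s)"
  using assms(1)
proof (cases rule: curvature_cases)
  case (pos k)
  then have s: "-1 < s" "s < 1" using assms by (auto simp: curvature_simps)
  have "((\<lambda>s. arccos s / k) has_real_derivative inverse (- sqrt (1 - s\<^sup>2)) / k) (at s)"
    by (intro DERIV_cdivide DERIV_arccos s)
  moreover have "inverse (- sqrt (1 - s\<^sup>2)) / k = - 1 / (K * sn K (acs K s))"
    using pos s by (simp add: curvature_simps sin_arccos field_simps power2_eq_square)
  moreover have "acs K = (\<lambda>s. arccos s / k)" using pos by (auto simp: curvature_simps)
  ultimately show ?thesis by simp
next
  case (neg k)
  then have s: "s > 1" using assms by (auto simp: curvature_simps)
  have "((\<lambda>s. arcosh s / k) has_real_derivative 1 / sqrt (s\<^sup>2 - 1) / k) (at s)"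
    using s by (intro DERIV_cdivide) (auto intro!: derivative_eq_intros)
  moreover have "1 / sqrt (s\<^sup>2 - 1) / k = - 1 / (K * sn K (acs K s))"
    using neg s by (simp add: curvature_simps sinh_arcosh_real power2_eq_square)
  moreover have "acs K = (\<lambda>s. arcosh s / k)" using neg by (auto simp: curvature_simps)
  ultimately show ?thesis by simp
qed

lemma continuous_on_acs:
  assumes "K \<noteq> 0" shows "continuous_on (cs_range K) (acs K)"
  using assms
proof (cases rule: curvature_cases)
  case (pos k)
  then have "acs K = (\<lambda>s. arccos s / k)" by (auto simp: curvature_simps)
  with pos show ?thesis by (auto simp: curvature_simps intro!: continuous_intros)
next
  case (neg k)
  then have "acs K = (\<lambda>s. arcosh s / k)" by (auto simp: curvature_simps)
  with neg show ?thesis by (auto simp: curvature_simps intro!: continuous_intros)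
qed

section \<open>The ambient form and the geodesics\<close>

lemma bounded_bilinear_form: "bounded_bilinear (form K :: 'a::euclidean_space \<times> real \<Rightarrow> _)"
proof -
  have "form K = (\<lambda>x y::'a \<times> real. x \<bullet> (fst y, sgn K *\<^sub>R snd y))"
    by (auto simp: fun_eq_iff form_def inner_prod_def)
  moreover have "bounded_bilinear (\<lambda>x y::'a \<times> real. x \<bullet> (fst y, sgn K *\<^sub>R snd y))"
    by (rule bounded_bilinear.comp[OF bounded_bilinear_inner bounded_linear_ident
          bounded_linear_Pair[OF bounded_linear_fst
            bounded_linear_compose[OF bounded_linear_scaleR_right bounded_linear_snd]]])
  ultimately show ?thesis by simp
qed

interpretation form: bounded_bilinear "form K" for K
  by (rule bounded_bilinear_form)

lemmas form_simps = form.add_left form.add_right form.diff_left form.diff_right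
  form.scaleR_left form.scaleR_right form.minus_left form.minus_right

lemma form_commute: "form K x y = form K y x"
  by (simp add: form_def inner_commute mult.commute)

lemma space_form_self: "x \<in> space_form K \<Longrightarrow> form K x x = 1 / K"
  by (simp add: space_form_def)

lemma tangentI: "form K x v = 0 \<Longrightarrow> v \<in> tangent K x"
  and tangentD: "v \<in> tangent K x \<Longrightarrow> form K x v = 0"
  by (auto simp: tangent_def)

lemma tangent_scaleR: "v \<in> tangent K x \<Longrightarrow> c *\<^sub>R v \<in> tangent K x"
  and tangent_diff: "v \<in> tangent K x \<Longrightarrow> w \<in> tangent K x \<Longrightarrow> v - w \<in> tangent K x"
  and tangent_minus: "v \<in> tangent K x \<Longrightarrow> - v \<in> tangent K x"
  by (auto simp: tangent_def form_simps)

text \<open>For K < 0 the form is indefinite, but the base point (p, q) satisfies |p|^2 < q^2.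
  Tangency of (s, t) says t q = p . s, and Cauchy-Schwarz then gives t^2 < |s|^2 unless s =
  0.\<close>

lemma form_tangent_pos:
  assumes "K \<noteq> 0" "x \<in> space_form K" "v \<in> tangent K x" "v \<noteq> 0"
  shows "form K v v > 0"
proof (cases "K > 0")
  case True
  then have "form K v v = v \<bullet> v" by (simp add: form_def inner_prod_def)
  then show ?thesis using assms by simp
next
  case False
  then have K: "K < 0" using assms by simp
  obtain p q where x: "x = (p, q)" by (cases x)
  obtain s t where v: "v = (s, t)" by (cases v)
  have q: "p \<bullet> p - q\<^sup>2 = 1 / K" "q > 0" and pq: "t * q = p \<bullet> s"
    using assms K by (auto simp: space_form_def tangent_def form_def x v power2_eq_square mult.commute)
  show ?thesis
  proof (cases "s = 0")
    case True
    then have "t = 0" using q pq by simp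
    then show ?thesis using True assms v by (simp add: zero_prod_def)
  next
    case False
    then have s: "s \<bullet> s > 0" by simp
    have "(t * q)\<^sup>2 \<le> (p \<bullet> p) * (s \<bullet> s)" using Cauchy_Schwarz_ineq[of p s] pq by simp
    also have "\<dots> = q\<^sup>2 * (s \<bullet> s) + (s \<bullet> s) / K" using q by (simp add: field_simps)
    also have "\<dots> < q\<^sup>2 * (s \<bullet> s)" using s K by (simp add: divide_pos_neg)
    finally have "q\<^sup>2 * t\<^sup>2 < q\<^sup>2 * (s \<bullet> s)" by (simp add: power_mult_distrib mult.commute)
    then have "t\<^sup>2 < s \<bullet> s" using q by simp
    then show ?thesis using K by (simp add: form_def v power2_eq_square)
  qed
qed

lemma form_tangent_nonneg:
  "K \<noteq> 0 \<Longrightarrow> x \<in> space_form K \<Longrightarrow> v \<in> tangent K x \<Longrightarrow> form K v v \<ge> 0"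
  by (cases "v = 0") (auto dest: form_tangent_pos simp: form.zero_left)

lemma form_cauchy_schwarz:
  assumes "K \<noteq> 0" "x \<in> space_form K" "v \<in> tangent K x" "w \<in> tangent K x"
  shows "(form K v w)\<^sup>2 \<le> form K v v * form K w w"
proof (cases "w = 0")
  case True
  then show ?thesis by (simp add: form.zero_right)
next
  case False
  then have w: "form K w w > 0" using form_tangent_pos assms by blast
  define c where "c = form K v w / form K w w"
  have "0 \<le> form K (v - c *\<^sub>R w) (v - c *\<^sub>R w)"
    using assms by (intro form_tangent_nonneg tangent_diff tangent_scaleR)
  also have "\<dots> = form K v v - 2 * c * form K v w + c\<^sup>2 * form K w w"
    by (simp add: form_simps form_commute[of K w v] power2_eq_square algebra_simps)
  also have "\<dots> = form K v v - (form K v w)\<^sup>2 / form K w w"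
    using w by (simp add: c_def power2_eq_square field_simps)
  finally have "(form K v w)\<^sup>2 / form K w w \<le> form K v v" by simp
  then show ?thesis using w by (simp add: pos_divide_le_eq)
qed

lemma tnorm_nonneg [simp]: "K \<noteq> 0 \<Longrightarrow> x \<in> space_form K \<Longrightarrow> v \<in> tangent K x \<Longrightarrow> tnorm K v \<ge> 0"
  by (auto simp: tnorm_def form_tangent_nonneg)

lemma tnorm_square:
  "K \<noteq> 0 \<Longrightarrow> x \<in> space_form K \<Longrightarrow> v \<in> tangent K x \<Longrightarrow> (tnorm K v)\<^sup>2 = form K v v"
  by (simp add: tnorm_def form_tangent_nonneg)

lemma tnorm_scaleR: "tnorm K (c *\<^sub>R v) = \<bar>c\<bar> * tnorm K v"
  by (simp add: tnorm_def form_simps real_sqrt_mult flip: mult.assoc)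

lemma tnorm_eq_0_iff:
  "K \<noteq> 0 \<Longrightarrow> x \<in> space_form K \<Longrightarrow> v \<in> tangent K x \<Longrightarrow> tnorm K v = 0 \<longleftrightarrow> v = 0"
  using form_tangent_pos[of K x v] by (cases "v = 0") (auto simp: tnorm_def form.zero_left)

text \<open>\<open>cosd K x y\<close> is the cosine of \<open>sqrt K\<close> times the distance of \<open>x\<close> and \<open>y\<close>, or the hyperbolic cosine
  of \<open>sqrt (- K)\<close> times the distance.\<close>

definition cosd :: "real \<Rightarrow> 'a::euclidean_space \<times> real \<Rightarrow> 'a \<times> real \<Rightarrow> real" where
  "cosd K x y = K * form K x y"

definition sdist :: "real \<Rightarrow> 'a::euclidean_space \<times> real \<Rightarrow> 'a \<times> real \<Rightarrow> real" where
  "sdist K x y = acs K (cosd K x y)"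

lemma cosd_commute: "cosd K x y = cosd K y x"
  by (simp add: cosd_def form_commute)

lemma sdist_commute: "sdist K x y = sdist K y x"
  by (simp add: sdist_def cosd_commute)

lemma cosd_self: "K \<noteq> 0 \<Longrightarrow> x \<in> space_form K \<Longrightarrow> cosd K x x = 1"
  by (simp add: cosd_def space_form_self)

text \<open>This component of y orthogonal to x is the direction in which the geodesic from x to y
  starts. Its square is \<open>(sn K r)\<^sup>2\<close> for r the distance. That it is nonnegative
  restricts \<open>cosd\<close> to the range of \<open>cs K\<close>; it vanishes only for y = x or y
  = - x.\<close>

lemma
  assumes "K \<noteq> 0" "x \<in> space_form K" "y \<in> space_form K"
  shows normal_part_tangent: "y - cosd K x y *\<^sub>R x \<in> tangent K x"
    and form_normal_part: "form K (y - cosd K x y *\<^sub>R x) (y - cosd K x y *\<^sub>R x) = (1 - (cosd K x y)\<^sup>2) / K"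
  using assms
  by (auto simp: tangent_def form_simps cosd_def space_form_self form_commute[of K y x] power2_eq_square field_simps)

text \<open>Both points lie strictly inside the light cone, so the product of the last coordinates
  outweighs the inner product of the others and decides the sign. This keeps geodesics and circles
  on the upper sheet.\<close>

lemma cosd_pos_iff:
  assumes "K < 0" "x \<in> space_form K" "form K y y = 1 / K"
  shows "cosd K x y > 0 \<longleftrightarrow> snd y > 0"
proof -
  obtain p q p' q' where x: "x = (p, q)" and y: "y = (p', q')" by (cases x, cases y)
  have q: "p \<bullet> p - q\<^sup>2 = 1 / K" "q > 0" "p' \<bullet> p' - q'\<^sup>2 = 1 / K"
    using assms by (auto simp: space_form_def form_def x y power2_eq_square)
  have "1 / K < 0" using assms by simp
  then have "(norm p)\<^sup>2 < q\<^sup>2" "(norm p')\<^sup>2 < \<bar>q'\<bar>\<^sup>2"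
    unfolding power2_norm_eq_inner power2_abs using q by linarith+
  then have "norm p < q" "norm p' < \<bar>q'\<bar>" using q by (simp_all add: power2_less_imp_less)
  then have "norm p * norm p' < q * \<bar>q'\<bar>" by (intro mult_strict_mono') auto
  then have *: "\<bar>p \<bullet> p'\<bar> < q * \<bar>q'\<bar>" using Cauchy_Schwarz_ineq2[of p p'] by linarith
  have "cosd K x y > 0 \<longleftrightarrow> p \<bullet> p' < q * q'"
    using assms(1) by (auto simp: cosd_def form_def x y zero_less_mult_iff)
  also have "\<dots> \<longleftrightarrow> q' > 0"
  proof (cases "q' > 0")
    case False
    then have "q * \<bar>q'\<bar> = - (q * q')" by simp
    then show ?thesis using * False q by linarith
  qed (use * in auto)
  finally show ?thesis by (simp add: y)
qed

lemma cosd_in_range: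
  assumes "K \<noteq> 0" "x \<in> space_form K" "y \<in> space_form K"
  shows "cosd K x y \<in> cs_range K"
proof -
  have *: "0 \<le> (1 - (cosd K x y)\<^sup>2) / K"
    using form_tangent_nonneg[OF assms(1,2) normal_part_tangent[OF assms]] form_normal_part[OF assms] by simp
  show ?thesis
  proof (cases "K > 0")
    case True
    then have "(cosd K x y)\<^sup>2 \<le> 1" using * by (simp add: zero_le_divide_iff)
    then show ?thesis using True by (simp add: cs_range_def abs_square_le_1 abs_le_iff)
  next
    case False
    then have K: "K < 0" using assms by simp
    have h: "1 \<le> (cosd K x y)\<^sup>2" using * K by (simp add: zero_le_divide_iff)
    have "form K y y = 1 / K" "snd y > 0" using assms K by (auto simp: space_form_def)
    then have "cosd K x y > 0" using cosd_pos_iff K assms by blast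
    then have "cosd K x y \<ge> 1" using h using power_less_one_iff[of "cosd K x y" 2] by force
    then show ?thesis using K by (simp add: cs_range_def)
  qed
qed

lemma cosd_eq_1_iff:
  assumes "K \<noteq> 0" "x \<in> space_form K" "y \<in> space_form K"
  shows "cosd K x y = 1 \<longleftrightarrow> x = y"
proof
  assume "cosd K x y = 1"
  then show "x = y"
    using form_tangent_pos[OF assms(1,2) normal_part_tangent[OF assms]] form_normal_part[OF assms] by force
qed (simp add: assms cosd_self)

lemma cosd_eq_minus_1:
  assumes "K \<noteq> 0" "x \<in> space_form K" "y \<in> space_form K" "cosd K x y = -1"
  shows "y = - x"
  using form_tangent_pos[OF assms(1,2) normal_part_tangent[OF assms(1-3)]] form_normal_part[OF assms(1-3)] assms(4)
  by (force simp: eq_neg_iff_add_eq_0)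

lemma
  assumes "K \<noteq> 0" "x \<in> space_form K" "y \<in> space_form K"
  shows cs_sdist: "cs K (sdist K x y) = cosd K x y"
    and sdist_nonneg: "sdist K x y \<ge> 0"
    and sdist_less: "cosd K x y \<noteq> -1 \<Longrightarrow> K > 0 \<Longrightarrow> sdist K x y < pi / sqrt K"
  using cosd_in_range[OF assms] assms by (auto simp: sdist_def cs_acs acs_nonneg acs_less)

lemma sdist_self: "K \<noteq> 0 \<Longrightarrow> x \<in> space_form K \<Longrightarrow> sdist K x x = 0"
  by (simp add: sdist_def cosd_self)

lemma sdist_eq_0_iff:
  assumes "K \<noteq> 0" "x \<in> space_form K" "y \<in> space_form K"
  shows "sdist K x y = 0 \<longleftrightarrow> x = y"
  by (metis assms cs_sdist cosd_eq_1_iff sdist_self cs_0)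

text \<open>For \<open>v = 0\<close> the junk value \<open>0 / 0 = 0\<close> makes this the constant curve, as it should be.\<close>

definition geod :: "real \<Rightarrow> 'a::euclidean_space \<times> real \<Rightarrow> 'a \<times> real \<Rightarrow> real \<Rightarrow> 'a \<times> real" where
  "geod K x v t = cs K (t * tnorm K v) *\<^sub>R x + (sn K (t * tnorm K v) / tnorm K v) *\<^sub>R v"

definition geod_deriv :: "real \<Rightarrow> 'a::euclidean_space \<times> real \<Rightarrow> 'a \<times> real \<Rightarrow> real \<Rightarrow> 'a \<times> real" where
  "geod_deriv K x v t = (- K * tnorm K v * sn K (t * tnorm K v)) *\<^sub>R x + cs K (t * tnorm K v) *\<^sub>R v"

lemma geod_0 [simp]: "geod K x v 0 = x" and geod_deriv_0 [simp]: "geod_deriv K x v 0 = v"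
  by (simp_all add: geod_def geod_deriv_def)

lemma has_vector_derivative_geod:
  assumes "K \<noteq> 0" "x \<in> space_form K" "v \<in> tangent K x"
  shows "(geod K x v has_vector_derivative geod_deriv K x v t) (at t within S)"
proof (cases "v = 0")
  case True
  then show ?thesis by (auto simp: geod_def[abs_def] geod_deriv_def tnorm_def form.zero_left)
next
  case False
  then have "tnorm K v \<noteq> 0" using tnorm_eq_0_iff assms by blast
  then show ?thesis
    unfolding geod_def geod_deriv_def using assms(1)
    by (auto intro!: derivative_eq_intros simp: algebra_simps)
qed

lemma has_vector_derivative_geod_deriv:
  assumes "K \<noteq> 0" "x \<in> space_form K" "v \<in> tangent K x"
  shows "(geod_deriv K x v has_vector_derivative (- K * form K v v) *\<^sub>R geod K x v t) (at t within S)"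
proof (cases "v = 0")
  case True
  then show ?thesis by (auto simp: geod_deriv_def[abs_def] tnorm_def form.zero_left)
next
  case False
  then have "tnorm K v \<noteq> 0" using tnorm_eq_0_iff assms by blast
  then show ?thesis
    unfolding geod_def geod_deriv_def tnorm_square[OF assms, symmetric] using assms(1)
    by (auto intro!: derivative_eq_intros simp: algebra_simps power2_eq_square)
qed

lemma
  assumes "K \<noteq> 0" "x \<in> space_form K" "v \<in> tangent K x"
  shows form_geod: "form K (geod K x v t) (geod K x v t) = 1 / K"
    and form_geod_deriv: "form K (geod_deriv K x v t) (geod_deriv K x v t) = form K v v"
    and cosd_geod: "cosd K x (geod K x v t) = cs K (t * tnorm K v)"
proof -
  have n: "(tnorm K v)\<^sup>2 = form K v v" by (rule tnorm_square[OF assms])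
  define c s where "c = cs K (t * tnorm K v)" and "s = sn K (t * tnorm K v)"
  have cs: "c\<^sup>2 + K * s\<^sup>2 = 1" unfolding c_def s_def by (rule cs_sn_identity[OF assms(1)])
  have x: "form K x x = 1 / K" "form K x v = 0" "form K v x = 0"
    using assms by (auto simp: space_form_self tangent_def form_commute)
  show "form K (geod_deriv K x v t) (geod_deriv K x v t) = form K v v"
  proof -
    have "form K (geod_deriv K x v t) (geod_deriv K x v t) =
       (K * tnorm K v * s)\<^sup>2 / K + c\<^sup>2 * form K v v"
      by (simp add: geod_deriv_def form_simps x c_def s_def power2_eq_square)
    also have "(K * tnorm K v * s)\<^sup>2 / K = K * s\<^sup>2 * (tnorm K v)\<^sup>2"
      using assms(1) by (simp add: power_mult_distrib power2_eq_square[of K])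
    also have "\<dots> + c\<^sup>2 * form K v v = (c\<^sup>2 + K * s\<^sup>2) * form K v v"
      unfolding n by (simp add: distrib_right)
    finally show ?thesis using cs by simp
  qed
  show "form K (geod K x v t) (geod K x v t) = 1 / K"
  proof (cases "v = 0")
    case True
    then show ?thesis using x by (simp add: geod_def tnorm_def form.zero_left)
  next
    case False
    then have "tnorm K v \<noteq> 0" using tnorm_eq_0_iff assms by blast
    have "form K (geod K x v t) (geod K x v t) = c\<^sup>2 / K + (s / tnorm K v)\<^sup>2 * form K v v"
      by (simp add: geod_def form_simps x c_def s_def power2_eq_square)
    also have "\<dots> = (c\<^sup>2 + K * s\<^sup>2) / K"
      using \<open>tnorm K v \<noteq> 0\<close> assms(1) unfolding n[symmetric] by (simp add: power_divide add_divide_distrib)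
    finally show ?thesis using cs by simp
  qed
  show "cosd K x (geod K x v t) = cs K (t * tnorm K v)"
    using assms(1) by (simp add: cosd_def geod_def form_simps x)
qed

lemma geod_in_space_form:
  assumes "K \<noteq> 0" "x \<in> space_form K" "v \<in> tangent K x"
  shows "geod K x v t \<in> space_form K"
  using form_geod[OF assms, of t] cosd_geod[OF assms, of t] cosd_pos_iff[of K x "geod K x v t"] assms
  by (auto simp: space_form_def cs_def)

section \<open>Exponential map, distance and logarithm\<close>

lemma has_vector_derivative_form:
  assumes "(f has_vector_derivative f') (at t within S)" "(g has_vector_derivative g') (at t within S)"
  shows "((\<lambda>t. form K (f t) (g t)) has_vector_derivative form K (f t) g' + form K f' (g t)) (at t within S)"
  by (rule form.has_vector_derivative[OF assms])

lemma geodesic_geod: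
  assumes "K \<noteq> 0" "x \<in> space_form K" "v \<in> tangent K x"
  shows "geodesic K (geod K x v)"
  unfolding geodesic_def
proof (intro conjI exI allI)
  show "range (geod K x v) \<subseteq> space_form K"
    using geod_in_space_form[OF assms] by auto
  fix t
  show "(geod K x v has_vector_derivative geod_deriv K x v t) (at t)"
    by (rule has_vector_derivative_geod[OF assms])
  show "(geod_deriv K x v has_vector_derivative (- K * form K v v) *\<^sub>R geod K x v t) (at t)"
    by (rule has_vector_derivative_geod_deriv[OF assms])
  show "tproj K (geod K x v t) ((- K * form K v v) *\<^sub>R geod K x v t) = 0"
    using assms(1) by (simp add: tproj_def form_simps form_geod[OF assms])
qed

lemma vector_constant:
  fixes f :: "real \<Rightarrow> 'a::real_normed_vector"
  assumes "\<And>t. (f has_vector_derivative 0) (at t)" shows "f t = f 0"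
  using assms has_derivative_zero_unique[of UNIV f 0 t]
  by (auto simp: has_vector_derivative_def)

lemma tangent_of_vector_derivative:
  assumes "(\<gamma> has_vector_derivative v) (at t)" "open S" "t \<in> S"
    "\<And>s. s \<in> S \<Longrightarrow> form K (\<gamma> s) (\<gamma> s) = c"
  shows "form K (\<gamma> t) v = 0"
proof -
  have "((\<lambda>t. form K (\<gamma> t) (\<gamma> t)) has_vector_derivative 2 * form K (\<gamma> t) v) (at t)"
    using has_vector_derivative_form[OF assms(1,1), of K] by (simp add: form_commute[of K v])
  moreover have "((\<lambda>t. form K (\<gamma> t) (\<gamma> t)) has_vector_derivative 0) (at t)"
    using assms(2-4) has_vector_derivative_transform_within_open[of "\<lambda>_. c" 0 t S] by auto
  ultimately show ?thesis
    using vector_derivative_unique_at by fastforce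
qed

text \<open>The speed is constant and the acceleration normal, hence \<gamma>'' = - K |v|^2
  \<gamma>. For this linear equation uniqueness is elementary: the inverse of the flow, applied to
  (\<gamma>, \<gamma>'), yields constants.\<close>

lemma geodesic_unique:
  assumes K: "K \<noteq> 0" and x: "x \<in> space_form K" and \<gamma>: "geodesic K \<gamma>" "\<gamma> 0 = x"
    and v: "(\<gamma> has_vector_derivative v) (at 0)"
  shows "\<gamma> t = geod K x v t"
proof -
  obtain \<gamma>' \<gamma>'' where d: "\<And>t. (\<gamma> has_vector_derivative \<gamma>' t) (at t)"
    "\<And>t. (\<gamma>' has_vector_derivative \<gamma>'' t) (at t)" and n: "\<And>t. tproj K (\<gamma> t) (\<gamma>'' t) = 0"
    using \<gamma>(1) unfolding geodesic_def by metis
  have sf: "\<gamma> t \<in> space_form K" for t using \<gamma>(1) by (auto simp: geodesic_def)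
  have v': "\<gamma>' 0 = v" using vector_derivative_unique_at[OF d(1) v] .
  have tan: "form K (\<gamma> t) (\<gamma>' t) = 0" for t
    by (rule tangent_of_vector_derivative[OF d(1), of UNIV]) (auto simp: space_form_self[OF sf])
  have acc: "form K (\<gamma> t) (\<gamma>'' t) = - form K (\<gamma>' t) (\<gamma>' t)" for t
  proof -
    have "((\<lambda>t. form K (\<gamma> t) (\<gamma>' t)) has_vector_derivative form K (\<gamma> t) (\<gamma>'' t) + form K (\<gamma>' t) (\<gamma>' t)) (at t)"
      by (rule has_vector_derivative_form[OF d])
    moreover have "((\<lambda>t. form K (\<gamma> t) (\<gamma>' t)) has_vector_derivative 0) (at t)"
      by (simp add: tan)
    ultimately show ?thesis using vector_derivative_unique_at by fastforce
  qed
  have \<gamma>'': "\<gamma>'' t = (- K * form K (\<gamma>' t) (\<gamma>' t)) *\<^sub>R \<gamma> t" for t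
    using n[of t] acc[of t] by (simp add: tproj_def eq_neg_iff_add_eq_0)
  have "((\<lambda>t. form K (\<gamma>' t) (\<gamma>' t)) has_vector_derivative 0) (at t)" for t
    using has_vector_derivative_form[OF d(2,2), of K t]
    by (simp add: \<gamma>'' form_simps tan form_commute[of K "\<gamma>' t" "\<gamma> t"])
  then have const: "form K (\<gamma>' t) (\<gamma>' t) = form K v v" for t
    using vector_constant[of "\<lambda>t. form K (\<gamma>' t) (\<gamma>' t)"] v' by simp
  have vt: "v \<in> tangent K x" using tan[of 0] \<gamma> v' by (simp add: tangent_def)
  show ?thesis
  proof (cases "v = 0")
    case True
    have "\<gamma>' t = 0" for t
      using const[of t] form_tangent_pos[OF K sf[of t], of "\<gamma>' t"] tan[of t] True
      by (auto simp: tangent_def form.zero_left)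
    then have "\<gamma> t = \<gamma> 0" using vector_constant[of \<gamma>] d(1) by simp
    then show ?thesis using True \<gamma> by (simp add: geod_def tnorm_def form.zero_left)
  next
    case False
    define m where "m = tnorm K v"
    have m: "m \<noteq> 0" using False tnorm_eq_0_iff[OF K x vt] by (simp add: m_def)
    have m2: "form K v v = m\<^sup>2" using tnorm_square[OF K x vt] by (simp add: m_def)
    \<comment> \<open>\<open>U\<close> and \<open>W\<close> run the state (\<gamma> t, \<gamma>' t)
      backwards by time t along the explicit solution, so they should be the initial position and
      velocity.\<close>
    define U where "U = (\<lambda>t. cs K (t * m) *\<^sub>R \<gamma> t - (sn K (t * m) / m) *\<^sub>R \<gamma>' t)"
    define W where "W = (\<lambda>t. (K * m * sn K (t * m)) *\<^sub>R \<gamma> t + cs K (t * m) *\<^sub>R \<gamma>' t)"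
    have "(U has_vector_derivative 0) (at t)" for t
      unfolding U_def
      by (rule derivative_eq_intros d K refl | simp add: K m)+
         (simp add: \<gamma>'' const m2 power2_eq_square m algebra_simps)
    then have U: "U t = x" for t using vector_constant[of U] \<gamma> by (simp add: U_def)
    have "(W has_vector_derivative 0) (at t)" for t
      unfolding W_def
      by (rule derivative_eq_intros d K refl | simp add: K m)+
         (simp add: \<gamma>'' const m2 power2_eq_square m algebra_simps)
    then have W: "W t = v" for t using vector_constant[of W] v' by (simp add: W_def)
    have "geod K x v t = cs K (t * m) *\<^sub>R U t + (sn K (t * m) / m) *\<^sub>R W t"
      by (simp only: U W geod_def m_def)
    also have "\<dots> = ((cs K (t * m))\<^sup>2 + K * (sn K (t * m))\<^sup>2) *\<^sub>R \<gamma> t"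
      using m by (simp add: U_def W_def algebra_simps power2_eq_square)
    also have "\<dots> = \<gamma> t" by (simp add: cs_sn_identity[OF K])
    finally show ?thesis by simp
  qed
qed

lemma rexp_eq:
  assumes "K \<noteq> 0" "x \<in> space_form K" "v \<in> tangent K x"
  shows "rexp K x v = geod K x v 1"
  unfolding rexp_def
proof (rule the_equality)
  show "\<exists>\<gamma>. geodesic K \<gamma> \<and> \<gamma> 0 = x \<and> (\<gamma> has_vector_derivative v) (at 0) \<and> \<gamma> 1 = geod K x v 1"
    using geodesic_geod[OF assms] has_vector_derivative_geod[OF assms, of 0 UNIV]
    by (intro exI[of _ "geod K x v"]) simp
qed (use geodesic_unique assms in metis)

text \<open>For \<open>x = y\<close> the junk value \<open>0 / 0 = 0\<close> gives the correct logarithm \<open>0\<close>.\<close>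

definition slog :: "real \<Rightarrow> 'a::euclidean_space \<times> real \<Rightarrow> 'a \<times> real \<Rightarrow> 'a \<times> real" where
  "slog K x y = (sdist K x y / sn K (sdist K x y)) *\<^sub>R (y - cosd K x y *\<^sub>R x)"

lemma sn_sdist_pos:
  assumes "K \<noteq> 0" "x \<in> space_form K" "y \<in> space_form K" "cosd K x y \<noteq> -1" "x \<noteq> y"
  shows "sn K (sdist K x y) > 0"
proof (rule sn_pos)
  show "sdist K x y > 0"
    using assms sdist_nonneg[OF assms(1-3)] sdist_eq_0_iff[OF assms(1-3)] by linarith
qed (use assms sdist_less[OF assms(1-4)] in auto)

lemma
  assumes "K \<noteq> 0" "x \<in> space_form K" "y \<in> space_form K" "cosd K x y \<noteq> -1"
  shows slog_tangent: "slog K x y \<in> tangent K x"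
    and form_slog: "form K (slog K x y) (slog K x y) = (sdist K x y)\<^sup>2"
    and tnorm_slog: "tnorm K (slog K x y) = sdist K x y"
    and geod_slog: "geod K x (slog K x y) 1 = y"
proof -
  show "slog K x y \<in> tangent K x"
    unfolding slog_def by (intro tangent_scaleR normal_part_tangent assms)
  show *: "form K (slog K x y) (slog K x y) = (sdist K x y)\<^sup>2"
  proof (cases "x = y")
    case True
    then show ?thesis using assms by (simp add: slog_def sdist_self form.zero_left)
  next
    case False
    then have "sn K (sdist K x y) > 0" using sn_sdist_pos assms by blast
    moreover have "(1 - (cosd K x y)\<^sup>2) / K = (sn K (sdist K x y))\<^sup>2"
      using cs_sn_identity[OF assms(1), of "sdist K x y"] assms(1) cs_sdist[OF assms(1-3)]
      by (simp add: field_simps)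
    ultimately show ?thesis
      unfolding slog_def form.scaleR_left form.scaleR_right form_normal_part[OF assms(1-3)]
      by (simp add: power2_eq_square)
  qed
  then show n: "tnorm K (slog K x y) = sdist K x y"
    using sdist_nonneg[OF assms(1-3)] by (simp add: tnorm_def)
  show "geod K x (slog K x y) 1 = y"
  proof (cases "x = y")
    case True
    then show ?thesis using assms unfolding geod_def n by (simp add: sdist_self)
  next
    case False
    then have "sn K (sdist K x y) > 0" "sdist K x y \<noteq> 0"
      using sn_sdist_pos sdist_eq_0_iff assms by blast+
    then show ?thesis
      using cs_sdist[OF assms(1-3)] unfolding geod_def n by (simp add: slog_def)
  qed
qed

section \<open>Lower bound for the length of curves\<close>

lemma cs_range_scale:
  assumes K: "K \<noteq> 0" and q: "q > 0" "K * (1 - q) > 0" and h: "h \<in> cs_range K"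
  shows "q * h \<in> cs_range K" "q * h \<noteq> 1" "q * h \<noteq> - 1"
proof -
  have "(K > 0 \<and> \<bar>q * h\<bar> < 1) \<or> (K < 0 \<and> q * h > 1)"
  proof (cases "K > 0")
    case True
    then have "q < 1" using q by (simp add: zero_less_mult_iff)
    moreover have "\<bar>h\<bar> \<le> 1" using h True by (auto simp: cs_range_def)
    then have "q * \<bar>h\<bar> \<le> q * 1" using q by (intro mult_left_mono) auto
    ultimately have "q * \<bar>h\<bar> < 1" by linarith
    then have "\<bar>q * h\<bar> < 1" using q by (simp add: abs_mult)
    then show ?thesis using True by simp
  next
    case False
    then have "q > 1" using q K by (simp add: zero_less_mult_iff)
    moreover have "h \<ge> 1" using h False by (auto simp: cs_range_def)
    then have "q * h \<ge> q * 1" using q by (intro mult_left_mono) auto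
    ultimately have "q * h > 1" by linarith
    then show ?thesis using False K by simp
  qed
  then show "q * h \<in> cs_range K" "q * h \<noteq> 1" "q * h \<noteq> - 1"
    by (auto simp: cs_range_def abs_less_iff)
qed

text \<open>Shrinking the cosine (for \<open>K > 0\<close>; enlarging it for \<open>K < 0\<close>) by a factor \<open>q\<close> keeps away from the
  points where the distance to \<open>x\<close> is not differentiable, without increasing the slope.\<close>

lemma sdist_calibration:
  assumes K: "K \<noteq> 0" and q: "q > 0" "K * (1 - q) > 0" and x: "x \<in> space_form K"
    and \<gamma>: "(\<gamma> has_vector_derivative v) (at t)" "open S" "t \<in> S" "\<And>s. s \<in> S \<Longrightarrow> \<gamma> s \<in> space_form K"
  obtains f' where "((\<lambda>t. acs K (q * cosd K x (\<gamma> t))) has_vector_derivative f') (at t)" "f' \<le> tnorm K v"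
proof -
  define h where "h = cosd K x (\<gamma> t)"
  define s where "s = sn K (acs K (q * h))"
  have sf: "\<gamma> t \<in> space_form K" using \<gamma> by simp
  have vt: "v \<in> tangent K (\<gamma> t)"
    by (rule tangentI, rule tangent_of_vector_derivative[OF \<gamma>(1-3)]) (use \<gamma>(4) space_form_self in blast)
  have h: "h \<in> cs_range K" unfolding h_def by (rule cosd_in_range[OF K x sf])
  note qh = cs_range_scale[OF K q h]
  have s2: "s\<^sup>2 = (1 - (q * h)\<^sup>2) / K"
    using cs_sn_identity[OF K, of "acs K (q * h)"] cs_acs[OF K qh(1)] K
    unfolding s_def[symmetric] by (simp add: field_simps)
  have "s > 0"
  proof -
    have "acs K (q * h) \<noteq> 0" using cs_acs[OF K qh(1)] qh(2) by (metis cs_0)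
    then have "acs K (q * h) > 0" using acs_nonneg[OF K qh(1)] by simp
    then show ?thesis unfolding s_def using K acs_less[OF _ qh(1,3)] by (intro sn_pos) auto
  qed
  define f' where "f' = - 1 / (K * s) * (q * (K * form K x v))"
  have D: "((\<lambda>t. q * (K * form K x (\<gamma> t))) has_real_derivative q * (K * form K x v)) (at t)"
    using has_vector_derivative_form[OF has_vector_derivative_const \<gamma>(1), of K x]
    by (intro DERIV_cmult) (simp add: has_real_derivative_iff_has_vector_derivative form.zero_left)
  have "(acs K has_real_derivative - 1 / (K * s)) (at (q * (K * form K x (\<gamma> t))))"
    using has_real_derivative_acs[OF K qh] by (simp add: s_def h_def cosd_def)
  then have "((\<lambda>t. acs K (q * cosd K x (\<gamma> t))) has_real_derivative f') (at t)"
    unfolding f'_def cosd_def by (rule DERIV_chain2[OF _ D])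
  moreover have "f' \<le> tnorm K v"
  proof -
    have f': "f' * s = - q * form K x v" using K \<open>s > 0\<close> by (simp add: f'_def)
    have h': "cosd K (\<gamma> t) x = h" by (simp add: h_def cosd_commute)
    have "form K x v = form K (x - h *\<^sub>R \<gamma> t) v"
      using tangentD[OF vt] by (simp add: form_simps)
    then have "(form K x v)\<^sup>2 \<le> (1 - h\<^sup>2) / K * form K v v"
      using form_cauchy_schwarz[OF K sf normal_part_tangent[OF K sf x] vt]
      by (simp add: form_normal_part[OF K sf x, unfolded h'] h')
    then have "q\<^sup>2 * (form K x v)\<^sup>2 \<le> q\<^sup>2 * ((1 - h\<^sup>2) / K * form K v v)"
      by (intro mult_left_mono) auto
    then have "(f' * s)\<^sup>2 \<le> q\<^sup>2 * (1 - h\<^sup>2) / K * form K v v"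
      unfolding f' by (simp add: power_mult_distrib)
    also have "\<dots> \<le> s\<^sup>2 * form K v v"
    proof (intro mult_right_mono form_tangent_nonneg[OF K sf vt])
      \<comment> \<open>The two sides differ by (1 - q^2) / K, which is positive for q on the chosen
        side of 1.\<close>
      have "s\<^sup>2 - q\<^sup>2 * (1 - h\<^sup>2) / K = (1 - q) / K * (1 + q)"
        unfolding s2 diff_divide_distrib[symmetric] times_divide_eq_left
        by (simp add: power_mult_distrib power2_eq_square algebra_simps)
      also have "\<dots> \<ge> 0"
        using q by (intro mult_nonneg_nonneg) (auto simp: zero_le_divide_iff zero_less_mult_iff)
      finally show "q\<^sup>2 * (1 - h\<^sup>2) / K \<le> s\<^sup>2" by simp
    qed
    finally have "f'\<^sup>2 \<le> form K v v" using \<open>s > 0\<close> by (simp add: power_mult_distrib mult.commute)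
    then have "f'\<^sup>2 \<le> (tnorm K v)\<^sup>2" using tnorm_square[OF K sf vt] by simp
    then show ?thesis by (rule power2_le_imp_le) (rule tnorm_nonneg[OF K sf vt])
  qed
  ultimately show ?thesis
    using that by (simp add: has_real_derivative_iff_has_vector_derivative)
qed

text \<open>The slope bound of \<open>sdist_calibration\<close>, integrated along the curve, bounds
  \<open>acs K (q * cosd K x y) - acs K q\<close> by the length; then q tends to 1.\<close>

lemma sdist_le_length:
  assumes K: "K \<noteq> 0" and \<gamma>: "valid_path \<gamma>" "speed K \<gamma> integrable_on {0..1}"
    "path_image \<gamma> \<subseteq> space_form K" "pathstart \<gamma> = x" "pathfinish \<gamma> = y"
  shows "sdist K x y \<le> integral {0..1} (speed K \<gamma>)"
proof -
  obtain S where S: "finite S" "\<gamma> C1_differentiable_on {0..1} - S" and cont: "continuous_on {0..1} \<gamma>"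
    using \<gamma>(1) by (auto simp: valid_path_def piecewise_C1_differentiable_on_def)
  have sf: "\<gamma> t \<in> space_form K" if "t \<in> {0..1}" for t
    using that \<gamma>(3) by (auto simp: path_image_def)
  have x: "x \<in> space_form K" and y: "y \<in> space_form K"
    using sf[of 0] sf[of 1] \<gamma>(4,5) by (auto simp: pathstart_def pathfinish_def)
  have bound: "acs K (q * cosd K x y) - acs K q \<le> integral {0..1} (speed K \<gamma>)"
    if q: "q > 0" "K * (1 - q) > 0" for q
  proof -
    define f where "f = (\<lambda>t. acs K (q * cosd K x (\<gamma> t)))"
    have ex: "\<exists>f'. (f has_vector_derivative f') (at t) \<and> f' \<le> speed K \<gamma> t" if "t \<in> {0<..<1} - S" for t
    proof -
      have "(\<gamma> has_vector_derivative vector_derivative \<gamma> (at t)) (at t)"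
        using S(2) that by (auto simp: C1_differentiable_on_eq vector_derivative_works)
      then show ?thesis
        using that sf
        by (auto intro: sdist_calibration[OF K q x, of \<gamma> _ t "{0<..<1}"] simp: f_def speed_def)
    qed
    then obtain f' where f': "\<And>t. t \<in> {0<..<1} - S \<Longrightarrow> (f has_vector_derivative f' t) (at t)"
      "\<And>t. t \<in> {0<..<1} - S \<Longrightarrow> f' t \<le> speed K \<gamma> t"
      by metis
    have qr: "q * s \<in> cs_range K" if "s \<in> cs_range K" for s
      using cs_range_scale[OF K q that] by simp
    have "continuous_on {0..1} (\<lambda>t. q * cosd K x (\<gamma> t))"
      unfolding cosd_def
      by (intro continuous_intros bounded_linear.continuous_on[OF form.bounded_linear_right] cont)
    then have "continuous_on {0..1} f"
      unfolding f_def using qr cosd_in_range[OF K x sf]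
      by (intro continuous_on_compose2[OF continuous_on_acs[OF K]]) auto
    then have int: "(f' has_integral f 1 - f 0) {0..1}"
      using f' S(1) by (intro fundamental_theorem_of_calculus_interior_strong[OF S(1)]) auto
    \<comment> \<open>At break points and end points nothing relates the chosen \<open>f'\<close> to
      the speed. Replacing the speed by \<open>f'\<close> on this finite set keeps the integral and
      makes the comparison hold everywhere.\<close>
    define g where "g = (\<lambda>t. if t \<in> S \<union> {0, 1} then f' t else speed K \<gamma> t)"
    have "(g has_integral integral {0..1} (speed K \<gamma>)) {0..1}"
      by (rule has_integral_spike_finite[OF _ _ integrable_integral[OF \<gamma>(2)], of "S \<union> {0, 1}"])
         (use S(1) in \<open>auto simp: g_def\<close>)
    then have "f 1 - f 0 \<le> integral {0..1} (speed K \<gamma>)"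
      by (rule has_integral_le[OF int]) (use f'(2) in \<open>auto simp: g_def\<close>)
    then show ?thesis
      using \<gamma>(4,5) cosd_self[OF K x] by (simp add: f_def pathstart_def pathfinish_def)
  qed
  \<comment> \<open>The sequence approaches 1 from below for K > 0 and from above for K < 0; the
    offset 2 keeps \<open>q 0\<close> positive.\<close>
  define q where "q = (\<lambda>n. 1 - sgn K / (real n + 2))"
  have "(\<lambda>n. 1 / (real n + 2)) \<longlonglongrightarrow> 0"
    using LIMSEQ_ignore_initial_segment[OF lim_1_over_n, of 2] by (simp add: add.commute)
  then have "(\<lambda>n. 1 - sgn K * (1 / (real n + 2))) \<longlonglongrightarrow> 1 - sgn K * 0"
    by (intro tendsto_intros)
  then have q_lim: "q \<longlonglongrightarrow> 1" by (simp add: q_def)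
  have q: "q n > 0" "K * (1 - q n) > 0" for n
    using K by (auto simp: q_def sgn_real_def field_simps)
  have lim: "(\<lambda>n. acs K (q n * s)) \<longlonglongrightarrow> acs K s" if "s \<in> cs_range K" for s
    by (rule continuous_on_tendsto_compose[OF continuous_on_acs[OF K]])
       (use cs_range_scale[OF K q that] that tendsto_mult_right[OF q_lim, of s] in auto)
  have "1 \<in> cs_range K" by (auto simp: cs_range_def)
  have "(\<lambda>n. acs K (q n * cosd K x y) - acs K (q n * 1)) \<longlonglongrightarrow> sdist K x y - acs K 1"
    unfolding sdist_def by (intro tendsto_diff lim cosd_in_range K x y \<open>1 \<in> cs_range K\<close>)
  then show ?thesis
    using q bound \<open>1 \<in> cs_range K\<close> by (intro LIMSEQ_le_const2[where X = "\<lambda>n. acs K (q n * cosd K x y) - acs K (q n * 1)"]) auto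
qed

lemma rdist_eq:
  assumes K: "K \<noteq> 0" and x: "x \<in> space_form K" and y: "y \<in> space_form K" and ne: "cosd K x y \<noteq> -1"
  shows "rdist K x y = sdist K x y"
  unfolding rdist_def
proof (rule cInf_eq_minimum)
  define v where "v = slog K x y"
  have v: "v \<in> tangent K x" unfolding v_def by (rule slog_tangent[OF assms])
  define \<gamma> where "\<gamma> = geod K x v"
  have d: "(\<gamma> has_vector_derivative geod_deriv K x v t) (at t)" for t
    unfolding \<gamma>_def by (rule has_vector_derivative_geod[OF K x v])
  have "speed K \<gamma> t = sdist K x y" for t
    unfolding speed_def vector_derivative_at[OF d] tnorm_def form_geod_deriv[OF K x v]
    using tnorm_slog[OF assms] by (simp add: v_def tnorm_def)
  then have sp: "speed K \<gamma> = (\<lambda>_. sdist K x y)" by auto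
  have "continuous_on {0..1} (geod_deriv K x v)"
    using has_vector_derivative_geod_deriv[OF K x v]
    by (intro continuous_at_imp_continuous_on) (auto intro: has_vector_derivative_continuous)
  then have "\<gamma> C1_differentiable_on {0..1}"
    unfolding C1_differentiable_on_def using d by blast
  then have "valid_path \<gamma>"
    by (simp add: valid_path_def C1_differentiable_imp_piecewise)
  moreover have "pathstart \<gamma> = x" "pathfinish \<gamma> = y"
    using geod_slog[OF assms] by (simp_all add: \<gamma>_def v_def pathstart_def pathfinish_def)
  moreover have "path_image \<gamma> \<subseteq> space_form K"
    using geod_in_space_form[OF K x v] by (auto simp: \<gamma>_def path_image_def)
  ultimately show "sdist K x y \<in> {integral {0..1} (speed K \<gamma>) |\<gamma>. valid_path \<gamma> \<and> speed K \<gamma> integrable_on {0..1} \<and>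
            path_image \<gamma> \<subseteq> space_form K \<and> pathstart \<gamma> = x \<and> pathfinish \<gamma> = y}"
    by (intro CollectI exI[of _ \<gamma>]) (auto simp: sp integrable_const_ivl)
qed (use sdist_le_length[OF K, of _ x y] in auto)

lemma rlog_eq:
  assumes K: "K \<noteq> 0" and x: "x \<in> space_form K" and y: "y \<in> space_form K" and ne: "cosd K x y \<noteq> -1"
  shows "rlog K x y = slog K x y"
  unfolding rlog_def rdist_eq[OF assms]
proof (rule the_equality)
  show "slog K x y \<in> tangent K x \<and> rexp K x (slog K x y) = y \<and> tnorm K (slog K x y) = sdist K x y"
    using slog_tangent[OF assms] rexp_eq[OF K x] geod_slog[OF assms] tnorm_slog[OF assms] by auto
next
  fix v assume v: "v \<in> tangent K x \<and> rexp K x v = y \<and> tnorm K v = sdist K x y"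
  then have g: "geod K x v 1 = y" using rexp_eq[OF K x] by metis
  show "v = slog K x y"
  proof (cases "x = y")
    case True
    then have d: "sdist K x y = 0" using sdist_eq_0_iff[OF K x y] by blast
    then have "v = 0" using v tnorm_eq_0_iff[OF K x] by metis
    then show ?thesis using d by (simp add: slog_def)
  next
    case False
    then have "sn K (sdist K x y) > 0" "sdist K x y \<noteq> 0"
      using sn_sdist_pos sdist_eq_0_iff assms by blast+
    moreover have e: "(sn K (sdist K x y) / sdist K x y) *\<^sub>R v = y - cosd K x y *\<^sub>R x"
      using g v cs_sdist[OF K x y] by (simp add: geod_def eq_diff_eq add.commute)
    ultimately show ?thesis unfolding slog_def e[symmetric] by simp
  qed
qed

section \<open>Regular polygons in a geodesic ball\<close>

locale space_ball =
  fixes K R :: real and x0 :: "'a::euclidean_space \<times> real"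
  assumes K: "K \<noteq> 0" and R: "R > 0" and R_less: "K > 0 \<Longrightarrow> R < pi / (2 * sqrt K)"
    and x0: "x0 \<in> space_form K"
begin

abbreviation B :: "('a \<times> real) set" where "B \<equiv> geo_ball K x0 R"

lemma R_less_pi: "K > 0 \<Longrightarrow> R < pi / sqrt K"
proof -
  assume "K > 0"
  then have "pi / (2 * sqrt K) \<le> pi / sqrt K" by (intro divide_left_mono) auto
  then show "R < pi / sqrt K" using R_less \<open>K > 0\<close> by linarith
qed

lemma cs_R: "cs K R > 0"
  using cs_pos K R R_less by simp

lemma sn_R: "sn K R > 0"
  using sn_pos K R R_less_pi by simp

lemma mem_ball: "p \<in> B \<longleftrightarrow> p \<in> space_form K \<and> sdist K x0 p \<le> R"
proof
  assume "p \<in> B"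
  then obtain v where v: "v \<in> tangent K x0" "tnorm K v \<le> R" "p = geod K x0 v 1"
    unfolding geo_ball_def using rexp_eq[OF K x0] by auto
  have n: "tnorm K v \<ge> 0" using tnorm_nonneg[OF K x0 v(1)] .
  have "sdist K x0 p = tnorm K v"
    using v(2,3) R_less_pi acs_cs[OF K n] by (simp add: sdist_def cosd_geod[OF K x0 v(1)]) linarith
  then show "p \<in> space_form K \<and> sdist K x0 p \<le> R"
    using v geod_in_space_form[OF K x0 v(1)] by simp
next
  assume p: "p \<in> space_form K \<and> sdist K x0 p \<le> R"
  then have "cs K (sdist K x0 p) > 0"
    using K R_less sdist_nonneg[OF K x0] by (intro cs_pos) fastforce+
  then have "cosd K x0 p \<noteq> -1" using cs_sdist[OF K x0 conjunct1[OF p]] by linarith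
  then have "slog K x0 p \<in> tangent K x0" "tnorm K (slog K x0 p) \<le> R" "rexp K x0 (slog K x0 p) = p"
    using p slog_tangent[OF K x0] tnorm_slog[OF K x0] geod_slog[OF K x0] rexp_eq[OF K x0] by auto
  then show "p \<in> B" unfolding geo_ball_def by force
qed

text \<open>\<open>cosd K x0 p\<close> is linear in p, so within the space form membership is an
  affine condition that can be checked on combinations of points, as in
  \<open>geodesic_segment\<close>.\<close>

lemma mem_ball_cosd: "p \<in> B \<longleftrightarrow> p \<in> space_form K \<and> K * (cosd K x0 p - cs K R) \<ge> 0"
proof (cases "p \<in> space_form K")
  case True
  have "K > 0 \<Longrightarrow> sdist K x0 p \<le> pi / sqrt K"
    using acs_le[OF K cosd_in_range[OF K x0 True]] by (simp add: sdist_def)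
  then have "K * (cs K (sdist K x0 p) - cs K R) \<ge> 0 \<longleftrightarrow> sdist K x0 p \<le> R"
    using R_less_pi R sdist_nonneg[OF K x0 True] by (intro cs_antimono[OF K]) auto
  then show ?thesis using True cs_sdist[OF K x0 True] by (simp add: mem_ball)
qed (simp add: mem_ball)

lemma ball_space_form: "p \<in> B \<Longrightarrow> p \<in> space_form K"
  by (simp add: mem_ball)

lemma center_mem_ball: "x0 \<in> B"
  using R by (simp add: mem_ball x0 sdist_self[OF K x0])

lemma ball_cosd_pos:
  assumes "p \<in> B" shows "cosd K x0 p > 0"
proof -
  have "cs K (sdist K x0 p) > 0"
    using K R_less assms sdist_nonneg[OF K x0, of p] unfolding mem_ball by (intro cs_pos) auto
  then show ?thesis using cs_sdist[OF K x0, of p] assms by (simp add: mem_ball)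
qed

text \<open>The ball lies in the open half space where \<open>cosd K x0\<close> is positive (for K >
  0 because R is below a quarter of a great circle), and negation leaves that half space.\<close>

lemma ball_not_antipodal:
  assumes "x \<in> B" "y \<in> B" shows "cosd K x y \<noteq> -1"
proof
  assume "cosd K x y = -1"
  then have "y = - x" by (intro cosd_eq_minus_1[OF K] ball_space_form assms)
  then have "cosd K x0 y = - cosd K x0 x" by (simp add: cosd_def form_simps)
  then show False using ball_cosd_pos[OF assms(1)] ball_cosd_pos[OF assms(2)] by linarith
qed

lemma ball_rdist: "x \<in> B \<Longrightarrow> y \<in> B \<Longrightarrow> rdist K x y = sdist K x y"
  and ball_rlog: "x \<in> B \<Longrightarrow> y \<in> B \<Longrightarrow> rlog K x y = slog K x y"
  by (simp_all add: rdist_eq[OF K] rlog_eq[OF K] ball_space_form ball_not_antipodal)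

end

section \<open>Sums over the polygon and their limit\<close>

lemma sum_periodic_shift:
  fixes f :: "nat \<Rightarrow> 'b::ab_group_add"
  assumes "f N = f 0"
  shows "(\<Sum>k<N. f (Suc k)) = (\<Sum>k<N. f k)"
  using sum.lessThan_Suc_shift[of f N] assms by (simp add: add.commute)

lemma cs_double: "K \<noteq> 0 \<Longrightarrow> cs K (2 * t) = 1 - 2 * K * (sn K t)\<^sup>2"
  using cs_add[of K t t] cs_sn_identity[of K t] by (simp add: power2_eq_square)

lemma sn_double: "K \<noteq> 0 \<Longrightarrow> sn K (2 * t) = 2 * sn K t * cs K t"
  using sn_add[of K t t] by simp

lemma isCont_cs: "K \<noteq> 0 \<Longrightarrow> isCont (cs K) t"
  using has_real_derivative_cs[OF _ DERIV_ident] DERIV_isCont by blast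

text \<open>With h = d / 2 the double angle formulas turn the quotient into sn h / (h cs h). It is
  the factor by which the bound from a polygon of side d differs from the bound for the
  circle.\<close>

lemma tendsto_half_angle:
  assumes K: "K \<noteq> 0"
  shows "((\<lambda>d. 2 * (1 - cs K d) / (K * d * sn K d)) \<longlongrightarrow> 1) (at 0)"
proof -
  have sn: "((\<lambda>h. sn K h / h) \<longlongrightarrow> 1) (at 0)"
    using has_real_derivative_sn[OF K DERIV_ident, of 0 UNIV] by (simp add: DERIV_def)
  have cs: "(cs K \<longlongrightarrow> 1) (at 0)" using isCont_cs[OF K, of 0] by (simp add: isCont_def)
  have "((\<lambda>h. sn K h / h / cs K h) \<longlongrightarrow> 1 / 1) (at 0)"
    by (intro tendsto_divide sn cs) simp
  moreover have half: "filterlim (\<lambda>d::real. d / 2) (at 0) (at 0)"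
    by (auto simp: filterlim_at eventually_at_filter intro!: tendsto_eq_intros)
  ultimately have "((\<lambda>d. sn K (d / 2) / (d / 2) / cs K (d / 2)) \<longlongrightarrow> 1) (at 0)"
    using filterlim_compose[of "\<lambda>h. sn K h / h / cs K h" "nhds 1" "at 0" "\<lambda>d. d / 2" "at 0"] by simp
  moreover have "eventually (\<lambda>d. sn K (d / 2) / (d / 2) / cs K (d / 2) = 2 * (1 - cs K d) / (K * d * sn K d)) (at 0)"
  proof -
    have "eventually (\<lambda>h. sn K h / h > 0) (at 0)" using sn by (rule order_tendstoD) simp
    then have "eventually (\<lambda>d. sn K (d/2) / (d/2) > 0) (at 0)" using half by (rule eventually_compose_filterlim)
    then show ?thesis
    proof (rule eventually_mono)
      fix d assume "sn K (d/2) / (d/2) > 0"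
      then have "sn K (d/2) \<noteq> 0" "d \<noteq> 0" by auto
      then show "sn K (d / 2) / (d / 2) / cs K (d / 2) = 2 * (1 - cs K d) / (K * d * sn K d)"
        using cs_double[OF K, of "d/2"] sn_double[OF K, of "d/2"] K
        by (simp add: power2_eq_square)
    qed
  qed
  ultimately show ?thesis by (rule Lim_transform_eventually)
qed

locale space_ball_plane = space_ball +
  fixes u1 u2 :: "'a \<times> real"
  assumes u: "u1 \<in> tangent K x0" "u2 \<in> tangent K x0"
    "form K u1 u1 = 1" "form K u2 u2 = 1" "form K u1 u2 = 0"
begin

definition dir :: "real \<Rightarrow> 'a \<times> real" where
  "dir \<theta> = cos \<theta> *\<^sub>R u1 + sin \<theta> *\<^sub>R u2"

definition circ :: "real \<Rightarrow> 'a \<times> real" where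
  "circ \<theta> = cs K R *\<^sub>R x0 + sn K R *\<^sub>R dir \<theta>"

lemma form_dir: "form K (dir \<theta>) (dir \<phi>) = cos (\<theta> - \<phi>)" "form K x0 (dir \<theta>) = 0" "form K (dir \<theta>) x0 = 0"
  using u by (simp_all add: dir_def form_simps form_commute[of K u2 u1] form_commute[of K _ x0] tangent_def cos_diff)

lemma dir_add_dir: "dir (\<theta> + \<alpha>) + dir (\<theta> - \<alpha>) = (2 * cos \<alpha>) *\<^sub>R dir \<theta>"
proof -
  have "dir (\<theta> + \<alpha>) + dir (\<theta> - \<alpha>) =
      (cos (\<theta> + \<alpha>) + cos (\<theta> - \<alpha>)) *\<^sub>R u1 + (sin (\<theta> + \<alpha>) + sin (\<theta> - \<alpha>)) *\<^sub>R u2"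
    by (simp add: dir_def scaleR_left_distrib)
  also have "cos (\<theta> + \<alpha>) + cos (\<theta> - \<alpha>) = 2 * cos \<alpha> * cos \<theta>" by (simp add: cos_add cos_diff)
  also have "sin (\<theta> + \<alpha>) + sin (\<theta> - \<alpha>) = 2 * cos \<alpha> * sin \<theta>" by (simp add: sin_add sin_diff)
  finally show ?thesis by (simp add: dir_def scaleR_right_distrib)
qed

lemma cosd_center_circ: "cosd K x0 (circ \<theta>) = cs K R"
  using K by (simp add: cosd_def circ_def form_simps form_dir space_form_self[OF x0])

lemma cosd_circ: "cosd K (circ \<theta>) (circ \<phi>) = (cs K R)\<^sup>2 + K * (sn K R)\<^sup>2 * cos (\<theta> - \<phi>)"
  using K by (simp add: cosd_def circ_def form_simps form_dir space_form_self[OF x0] power2_eq_square field_simps)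

lemma circ_space_form: "circ \<theta> \<in> space_form K"
proof -
  have "K * form K (circ \<theta>) (circ \<theta>) = 1"
    using cosd_circ[of \<theta> \<theta>] cs_sn_identity[OF K, of R] by (simp add: cosd_def)
  then have "form K (circ \<theta>) (circ \<theta>) = 1 / K" using K by (simp add: field_simps)
  then show ?thesis
    using cosd_pos_iff[OF _ x0, of "circ \<theta>"] cs_R by (auto simp: space_form_def cosd_center_circ)
qed

lemma circ_mem_ball: "circ \<theta> \<in> B"
  using circ_space_form by (simp add: mem_ball_cosd cosd_center_circ)

lemma sdist_center_circ: "sdist K x0 (circ \<theta>) = R"
  unfolding sdist_def cosd_center_circ using R R_less_pi by (intro acs_cs[OF K]) auto

lemma slog_center_circ: "slog K x0 (circ \<theta>) = R *\<^sub>R dir \<theta>"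
  unfolding slog_def sdist_center_circ cosd_center_circ using sn_R by (simp add: circ_def)

lemma slog_circ_center: "slog K (circ \<theta>) x0 = (R / sn K R) *\<^sub>R (x0 - cs K R *\<^sub>R circ \<theta>)"
  by (simp add: slog_def sdist_commute[of K _ x0] cosd_commute[of K _ x0] sdist_center_circ cosd_center_circ)

text \<open>By the law of cosines, the side opposite an angle \<alpha> at \<open>x0\<close> between
  two radii of length R: the side of the polygon.\<close>

definition chord :: "real \<Rightarrow> real" where
  "chord \<alpha> = acs K ((cs K R)\<^sup>2 + K * (sn K R)\<^sup>2 * cos \<alpha>)"

lemma sdist_circ: "sdist K (circ \<theta>) (circ (\<theta> + \<alpha>)) = chord \<alpha>" "sdist K (circ \<theta>) (circ (\<theta> - \<alpha>)) = chord \<alpha>"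
  by (simp_all add: sdist_def cosd_circ chord_def)

text \<open>Reflection in the radius exchanges the two neighbours, so the velocities towards them
  add up to a radial vector. The factor \<open>sn K R / R\<close> turns the unnormalised direction
  of \<open>x0\<close> into \<open>slog\<close>.\<close>

lemma slog_neighbours:
  "slog K (circ \<theta>) (circ (\<theta> + \<alpha>)) + slog K (circ \<theta>) (circ (\<theta> - \<alpha>)) =
    (chord \<alpha> / sn K (chord \<alpha>) * (2 * cs K R * (1 - cos \<alpha>)) * (sn K R / R)) *\<^sub>R slog K (circ \<theta>) x0"
proof -
  define c where "c = (cs K R)\<^sup>2 + K * (sn K R)\<^sup>2 * cos \<alpha>"
  \<comment> \<open>In this form the coefficient 2 cos \<alpha> - 2 c of
    \<open>circ \<theta>\<close> below shows the factor 1 - cos \<alpha> that the coefficient of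
    \<open>x0\<close> has.\<close>
  have c: "c = cos \<alpha> + (cs K R)\<^sup>2 * (1 - cos \<alpha>)"
    using cs_sn_identity[OF K, of R] unfolding c_def by algebra
  have "circ (\<theta> + \<alpha>) + circ (\<theta> - \<alpha>) = (2 * cs K R) *\<^sub>R x0 + sn K R *\<^sub>R (dir (\<theta> + \<alpha>) + dir (\<theta> - \<alpha>))"
    unfolding circ_def mult_2 scaleR_left_distrib scaleR_right_distrib by (simp only: add_ac)
  also have "\<dots> = (2 * cs K R * (1 - cos \<alpha>)) *\<^sub>R x0 + (2 * cos \<alpha>) *\<^sub>R circ \<theta>"
    unfolding dir_add_dir by (simp add: circ_def algebra_simps)
  finally have *: "(circ (\<theta> + \<alpha>) - c *\<^sub>R circ \<theta>) + (circ (\<theta> - \<alpha>) - c *\<^sub>R circ \<theta>) =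
      (2 * cs K R * (1 - cos \<alpha>)) *\<^sub>R x0 + (2 * cos \<alpha>) *\<^sub>R circ \<theta> - (2 * c) *\<^sub>R circ \<theta>"
    unfolding mult_2[of c] scaleR_left_distrib[of c] by (simp add: algebra_simps)
  also have "\<dots> = (2 * cs K R * (1 - cos \<alpha>)) *\<^sub>R (x0 - cs K R *\<^sub>R circ \<theta>)"
    unfolding c by (simp add: algebra_simps power2_eq_square)
  finally have "slog K (circ \<theta>) (circ (\<theta> + \<alpha>)) + slog K (circ \<theta>) (circ (\<theta> - \<alpha>)) =
     (chord \<alpha> / sn K (chord \<alpha>)) *\<^sub>R ((2 * cs K R * (1 - cos \<alpha>)) *\<^sub>R (x0 - cs K R *\<^sub>R circ \<theta>))"
    unfolding slog_def sdist_circ cosd_circ scaleR_right_distrib[symmetric]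
    by (simp add: c_def)
  then show ?thesis using R sn_R by (simp add: slog_circ_center)
qed

text \<open>The first inequality comes from the spokes in both directions, the second from the two
  sides at each vertex. \<open>G\<close> is an arbitrary vector field and \<open>L\<close> an
  arbitrary real, so that the lemma applies also to - F, - G and - \<mu>.\<close>

lemma polygon:
  fixes F :: "'a \<times> real \<Rightarrow> real" and N :: nat and \<alpha> L :: real
  assumes F: "\<And>x y. x \<in> B \<Longrightarrow> y \<in> B \<Longrightarrow> F y \<le> F x + form K (G x) (slog K x y) + L / 2 * (sdist K x y)\<^sup>2"
    and N: "N \<ge> 2" and \<alpha>: "\<alpha> = 2 * pi / N"
  defines "E \<equiv> \<Sum>k<N. form K (G (circ (k * \<alpha>))) (slog K (circ (k * \<alpha>)) x0)"
  shows "0 \<le> E + N * L * R\<^sup>2"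
    and "0 \<le> chord \<alpha> / sn K (chord \<alpha>) * (2 * cs K R * (1 - cos \<alpha>)) * (sn K R / R) * E + N * L * (chord \<alpha>)\<^sup>2"
proof -
  define e where "e = (\<lambda>k::nat. form K (G (circ (k * \<alpha>))) (slog K (circ (k * \<alpha>)) x0))"
  define f where "f = (\<lambda>k::nat. F (circ (k * \<alpha>)))"
  define w where "w = (\<lambda>k::nat. form K (G x0) (dir (k * \<alpha>)))"
  define \<kappa> where "\<kappa> = chord \<alpha> / sn K (chord \<alpha>) * (2 * cs K R * (1 - cos \<alpha>)) * (sn K R / R)"
  have N\<alpha>: "N * \<alpha> = 2 * pi" using N \<alpha> by simp
  have dir_per: "dir (real (k + N) * \<alpha>) = dir (k * \<alpha>)" for k
    by (simp add: dir_def distrib_right N\<alpha>)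
  then have circ_per: "circ (real (k + N) * \<alpha>) = circ (k * \<alpha>)" for k
    by (simp only: circ_def)
  have shift: "(\<Sum>k<N. h (Suc k)) = (\<Sum>k<N. h k)" "(\<Sum>k<N. h (Suc (Suc k))) = (\<Sum>k<N. h k)"
    if "\<And>k. h (k + N) = h k" for h :: "nat \<Rightarrow> real"
    using sum_periodic_shift[of h N] sum_periodic_shift[of "\<lambda>k. h (Suc k)" N] that[of 0] that[of 1]
    by simp_all
  have per: "e (k + N) = e k" "f (k + N) = f k" "w (k + N) = w k" for k
    by (simp_all only: e_def f_def w_def dir_per circ_per)
  \<comment> \<open>Vertex k + 1 is the middle one of three, so that its neighbours k and k + 2 have
    natural indices.\<close>
  have Suc: "real (k + 2) * \<alpha> = real (k + 1) * \<alpha> + \<alpha>" "real k * \<alpha> = real (k + 1) * \<alpha> - \<alpha>" for k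
    by (simp_all add: algebra_simps)
  \<comment> \<open>Summing this recurrence over a period gives W = cos \<alpha> W for the sum W of
    \<open>w\<close>, hence W = 0: the directions of the vertices balance at
    \<open>x0\<close>.\<close>
  have "w (k + 2) + w k = 2 * cos \<alpha> * w (k + 1)" for k
    unfolding w_def Suc[of k] form.add_right[symmetric] dir_add_dir by (simp add: form_simps)
  then have "(\<Sum>k<N. w (k + 2) + w k) = (\<Sum>k<N. 2 * cos \<alpha> * w (k + 1))" by (simp only:)
  then have "(\<Sum>k<N. w k) = cos \<alpha> * (\<Sum>k<N. w k)"
    by (simp add: sum.distrib shift[of w, OF per(3)] flip: sum_distrib_left)
  moreover have "cos \<alpha> \<noteq> 1"
  proof -
    have "\<alpha> > 0" "\<alpha> \<le> pi" using N by (auto simp: \<alpha> field_simps)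
    then have "cos \<alpha> < cos 0" by (intro cos_monotone_0_pi) auto
    then show ?thesis by simp
  qed
  ultimately have W: "(\<Sum>k<N. w k) = 0" by simp
  have "0 \<le> R * w k + e k + L * R\<^sup>2" for k
    using F[OF center_mem_ball circ_mem_ball, of "k * \<alpha>"] F[OF circ_mem_ball center_mem_ball, of "k * \<alpha>"]
    by (simp add: sdist_commute[of K _ x0] sdist_center_circ slog_center_circ form_simps e_def w_def)
  then have "0 \<le> (\<Sum>k<N. R * w k + e k + L * R\<^sup>2)" by (intro sum_nonneg) auto
  then show "0 \<le> E + N * L * R\<^sup>2"
    using W by (simp add: sum.distrib E_def e_def flip: sum_distrib_left)
  \<comment> \<open>The second differences of \<open>f\<close> sum to 0 over a period.\<close>
  have "0 \<le> 2 * f (k + 1) - f (k + 2) - f k + \<kappa> * e (k + 1) + L * (chord \<alpha>)\<^sup>2" for k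
  proof -
    define \<theta> where "\<theta> = real (k + 1) * \<alpha>"
    have "F (circ (\<theta> + \<alpha>)) + F (circ (\<theta> - \<alpha>)) \<le> 2 * F (circ \<theta>) +
      form K (G (circ \<theta>)) (slog K (circ \<theta>) (circ (\<theta> + \<alpha>)) + slog K (circ \<theta>) (circ (\<theta> - \<alpha>))) + L * (chord \<alpha>)\<^sup>2"
      using F[OF circ_mem_ball circ_mem_ball, of "\<theta> + \<alpha>" \<theta>] F[OF circ_mem_ball circ_mem_ball, of "\<theta> - \<alpha>" \<theta>]
      by (simp add: sdist_circ form.add_right)
    then show ?thesis
      unfolding slog_neighbours f_def e_def Suc[of k] \<theta>_def[symmetric] by (simp add: form_simps \<kappa>_def)
  qed
  then have "0 \<le> (\<Sum>k<N. 2 * f (k + 1) - f (k + 2) - f k + \<kappa> * e (k + 1) + L * (chord \<alpha>)\<^sup>2)"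
    by (intro sum_nonneg) auto
  then have "0 \<le> \<kappa> * (\<Sum>k<N. e k) + N * L * (chord \<alpha>)\<^sup>2"
    by (simp add: sum.distrib sum_subtractf shift[of e, OF per(1)] shift[of f, OF per(2)] flip: sum_distrib_left)
  then show "0 \<le> chord \<alpha> / sn K (chord \<alpha>) * (2 * cs K R * (1 - cos \<alpha>)) * (sn K R / R) * E + N * L * (chord \<alpha>)\<^sup>2"
    by (simp add: \<kappa>_def E_def e_def)
qed

text \<open>The identity \<open>1 - cs K (chord \<alpha>) = K * (sn K R)\<^sup>2 * (1 - cos
  \<alpha>)\<close> exchanges the central angle for the side. It brings the coefficient of
  \<open>slog_neighbours\<close> to the quotient of \<open>tendsto_half_angle\<close>.\<close>

lemma
  assumes "0 < \<alpha>" "\<alpha> \<le> pi"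
  shows chord_pos: "chord \<alpha> > 0"
    and sn_chord_pos: "sn K (chord \<alpha>) > 0"
    and chord_coefficient: "2 * cs K R * (1 - cos \<alpha>) * (sn K R / R) =
      cs K R / (R * sn K R) * (2 * (1 - cs K (chord \<alpha>)) / K)"
proof -
  have c1: "cos \<alpha> \<noteq> 1" using cos_monotone_0_pi[of 0 \<alpha>] assms by simp
  have s: "sdist K (circ 0) (circ \<alpha>) = chord \<alpha>" using sdist_circ(1)[of 0 \<alpha>] by simp
  note sf = circ_space_form[of 0] circ_space_form[of \<alpha>]
  have c: "cs K (chord \<alpha>) = (cs K R)\<^sup>2 + K * (sn K R)\<^sup>2 * cos \<alpha>"
    using cs_sdist[OF K sf] by (simp add: s cosd_circ)
  then have c2: "1 - cs K (chord \<alpha>) = K * (sn K R)\<^sup>2 * (1 - cos \<alpha>)"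
    using cs_sn_identity[OF K, of R] by (simp add: algebra_simps)
  then have ne: "circ 0 \<noteq> circ \<alpha>"
    using c1 K sn_R cosd_self[OF K sf(1)] cosd_circ[of 0 \<alpha>] c by auto
  show "sn K (chord \<alpha>) > 0"
    using sn_sdist_pos[OF K sf ball_not_antipodal[OF circ_mem_ball circ_mem_ball] ne] by (simp add: s)
  show "chord \<alpha> > 0"
    using sdist_nonneg[OF K sf] sdist_eq_0_iff[OF K sf] ne s by simp
  show "2 * cs K R * (1 - cos \<alpha>) * (sn K R / R) = cs K R / (R * sn K R) * (2 * (1 - cs K (chord \<alpha>)) / K)"
    unfolding c2 using K R sn_R by (simp add: power2_eq_square)
qed

lemma chord_tendsto: "(chord \<longlongrightarrow> 0) (at 0)"
proof -
  have "((\<lambda>\<alpha>. (cs K R)\<^sup>2 + K * (sn K R)\<^sup>2 * cos \<alpha>) \<longlongrightarrow> (cs K R)\<^sup>2 + K * (sn K R)\<^sup>2 * cos 0) (at 0)"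
    by (intro tendsto_intros)
  then have *: "((\<lambda>\<alpha>. (cs K R)\<^sup>2 + K * (sn K R)\<^sup>2 * cos \<alpha>) \<longlongrightarrow> 1) (at 0)"
    by (simp add: cs_sn_identity[OF K])
  have "(cs K R)\<^sup>2 + K * (sn K R)\<^sup>2 * cos \<alpha> \<in> cs_range K" for \<alpha>
    using cosd_in_range[OF K circ_space_form circ_space_form, of \<alpha> 0] by (simp add: cosd_circ)
  then have "((\<lambda>\<alpha>. acs K ((cs K R)\<^sup>2 + K * (sn K R)\<^sup>2 * cos \<alpha>)) \<longlongrightarrow> acs K 1) (at 0)"
    by (intro continuous_on_tendsto_compose[OF continuous_on_acs[OF K] *]) (auto simp: cs_range_def)
  then show ?thesis by (simp add: chord_def[abs_def])
qed

text \<open>With E and the coefficient \<kappa> of \<open>polygon\<close> and sides of length d, - E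
  / N lies between \<mu> R^2 and L R^2, and - \<kappa> E / N between \<mu> d^2 and L d^2. Comparing
  opposite ends eliminates E, and \<kappa> R^2 / d^2 tends to \<rho>.\<close>

lemma smooth_convex_ratio:
  assumes up: "\<And>x y. x \<in> B \<Longrightarrow> y \<in> B \<Longrightarrow> F y \<le> F x + form K (G x) (slog K x y) + L / 2 * (sdist K x y)\<^sup>2"
    and lo: "\<And>x y. x \<in> B \<Longrightarrow> y \<in> B \<Longrightarrow> F y \<ge> F x + form K (G x) (slog K x y) + \<mu> / 2 * (sdist K x y)\<^sup>2"
  shows "\<mu> * (R * cs K R / sn K R) \<le> L" and "\<mu> \<le> L * (R * cs K R / sn K R)"
proof -
  define \<rho> where "\<rho> = R * cs K R / sn K R"
  \<comment> \<open>There are n + 2 vertices, since \<open>polygon\<close> asks for at least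
    two.\<close>
  define \<alpha> where "\<alpha> = (\<lambda>n::nat. 2 * pi / (n + 2))"
  define d where "d = (\<lambda>n. chord (\<alpha> n))"
  define \<beta> where "\<beta> = (\<lambda>d. 2 * (1 - cs K d) / (K * d * sn K d))"
  have \<alpha>: "0 < \<alpha> n" "\<alpha> n \<le> pi" for n by (auto simp: \<alpha>_def field_simps)
  have d: "d n > 0" for n unfolding d_def using chord_pos[OF \<alpha>] .
  have "(\<lambda>n. 1 / (real n + 2)) \<longlonglongrightarrow> 0"
    using LIMSEQ_ignore_initial_segment[OF lim_1_over_n, of 2] by (simp add: add.commute)
  then have "(\<lambda>n. (2 * pi) * (1 / (real n + 2))) \<longlonglongrightarrow> (2 * pi) * 0" by (intro tendsto_intros)
  then have "\<alpha> \<longlonglongrightarrow> 0" by (simp add: \<alpha>_def)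
  then have "filterlim \<alpha> (at 0) sequentially" using \<alpha> by (auto simp: filterlim_at less_imp_neq[THEN not_sym])
  then have "d \<longlonglongrightarrow> 0" unfolding d_def by (rule filterlim_compose[OF chord_tendsto])
  then have "filterlim d (at 0) sequentially" using d by (auto simp: filterlim_at less_imp_neq[THEN not_sym])
  then have \<beta>: "(\<lambda>n. \<beta> (d n)) \<longlonglongrightarrow> 1"
    unfolding \<beta>_def by (rule filterlim_compose[OF tendsto_half_angle[OF K]])
  have up': "- F y \<le> - F x + form K (- G x) (slog K x y) + (- \<mu>) / 2 * (sdist K x y)\<^sup>2"
    if "x \<in> B" "y \<in> B" for x y using lo[OF that] by (simp add: form_simps)
  have fin: "\<mu> * (\<rho> * \<beta> (d n)) \<le> L \<and> \<mu> \<le> L * (\<rho> * \<beta> (d n))" for n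
  proof -
    define E where "E = (\<Sum>k<n + 2. form K (G (circ (k * \<alpha> n))) (slog K (circ (k * \<alpha> n)) x0))"
    define \<kappa> where "\<kappa> = d n / sn K (d n) * (2 * cs K R * (1 - cos (\<alpha> n))) * (sn K R / R)"
    define N where "N = real (n + 2)"
    have N: "N > 0" by (simp add: N_def)
    have \<alpha>_eq: "\<alpha> n = 2 * pi / real (n + 2)" by (simp add: \<alpha>_def)
    note p = polygon[OF up _ \<alpha>_eq]
      polygon[where F = "\<lambda>x. - F x" and G = "\<lambda>x. - G x", OF up' _ \<alpha>_eq]
    have 1: "0 \<le> E + N * L * R\<^sup>2" "0 \<le> \<kappa> * E + N * L * (d n)\<^sup>2"
      unfolding N_def E_def \<kappa>_def d_def by (intro p(1,2); simp)+
    have "0 \<le> - E + N * (- \<mu>) * R\<^sup>2" "0 \<le> \<kappa> * (- E) + N * (- \<mu>) * (d n)\<^sup>2"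
      unfolding N_def E_def \<kappa>_def d_def sum_negf[symmetric] form.minus_left[symmetric]
      by (intro p(3,4); simp)+
    then have 2: "E + N * \<mu> * R\<^sup>2 \<le> 0" "\<kappa> * E + N * \<mu> * (d n)\<^sup>2 \<le> 0" by simp_all
    have sn: "sn K (d n) > 0" unfolding d_def using sn_chord_pos[OF \<alpha>] .
    have \<kappa>: "\<kappa> * R\<^sup>2 = (\<rho> * \<beta> (d n)) * (d n)\<^sup>2"
    proof -
      have "\<kappa> = d n / sn K (d n) * (cs K R / (R * sn K R) * (2 * (1 - cs K (d n)) / K))"
        unfolding \<kappa>_def d_def chord_coefficient[OF \<alpha>, symmetric] by simp
      then show ?thesis using d[of n] R by (simp add: \<rho>_def \<beta>_def power2_eq_square mult_ac)
    qed
    have "cos (\<alpha> n) < 1" using cos_monotone_0_pi[of 0 "\<alpha> n"] \<alpha> by simp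
    then have "\<kappa> > 0" unfolding \<kappa>_def using sn d[of n] cs_R sn_R R by simp
    have "\<kappa> * (E + N * \<mu> * R\<^sup>2) \<le> 0" using 2 \<open>\<kappa> > 0\<close> by (simp add: mult_le_0_iff)
    then have "N * (\<mu> * (\<kappa> * R\<^sup>2)) \<le> N * (L * (d n)\<^sup>2)" using 1(2) by (simp add: algebra_simps)
    then have a: "\<mu> * (\<rho> * \<beta> (d n)) * (d n)\<^sup>2 \<le> L * (d n)\<^sup>2" using N \<kappa> by (simp add: mult.assoc)
    have "\<kappa> * (E + N * L * R\<^sup>2) \<ge> 0" using 1 \<open>\<kappa> > 0\<close> by simp
    then have "N * (\<mu> * (d n)\<^sup>2) \<le> N * (L * (\<kappa> * R\<^sup>2))" using 2(2) by (simp add: algebra_simps)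
    then have b: "\<mu> * (d n)\<^sup>2 \<le> L * (\<rho> * \<beta> (d n)) * (d n)\<^sup>2" using N \<kappa> by (simp add: mult.assoc)
    show ?thesis using a b d[of n] by simp
  qed
  have "(\<lambda>n. \<mu> * (\<rho> * \<beta> (d n))) \<longlonglongrightarrow> \<mu> * (\<rho> * 1)" "(\<lambda>n. L * (\<rho> * \<beta> (d n))) \<longlonglongrightarrow> L * (\<rho> * 1)"
    by (intro tendsto_intros \<beta>)+
  then have "\<mu> * (\<rho> * 1) \<le> L" "\<mu> \<le> L * (\<rho> * 1)"
    using fin by (auto intro: LIMSEQ_le_const2 LIMSEQ_le_const)
  then show "\<mu> * (R * cs K R / sn K R) \<le> L" and "\<mu> \<le> L * (R * cs K R / sn K R)"
    by (simp_all add: \<rho>_def)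
qed

end

section \<open>Half the squared distance along a geodesic\<close>

text \<open>The Hessian of half the squared distance to a point has eigenvalue \<open>1\<close> in the radial direction and
  \<open>hess K r\<close> in the orthogonal ones, where \<open>r\<close> is the distance.\<close>

definition hess :: "real \<Rightarrow> real \<Rightarrow> real" where
  "hess K r = r * cs K r / sn K r"

text \<open>For curvature 1 and - 1: r cot r is at most 1 and decreasing, r coth r at least 1 and
  increasing. This reduces to the signs of sn t - t cs t and t - cs t sn t, which vanish at 0 and
  whose derivatives, multiplied by K, are K^2 t sn t and 2 K^2 (sn t)^2.\<close>

lemma
  assumes K: "K \<noteq> 0" and r: "0 < r" "K > 0 \<Longrightarrow> r < pi / sqrt K"
  shows hess_le_1: "K * (1 - hess K r) \<ge> 0"
    and hess_antimono: "0 < s \<Longrightarrow> s \<le> r \<Longrightarrow> K * (hess K s - hess K r) \<ge> 0"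
proof -
  have sn: "sn K t > 0" if "0 < t" "t \<le> r" for t using sn_pos K r that by force
  have sn': "sn K t \<ge> 0" if "0 \<le> t" "t \<le> r" for t using sn[of t] that by (cases "t = 0") auto
  have "K * (sn K t - t * cs K t) \<ge> K * (sn K 0 - 0 * cs K 0)" if t: "0 \<le> t" "t \<le> r" for t
  proof (rule DERIV_nonneg_imp_nondecreasing[OF t(1)])
    fix u assume u: "0 \<le> u" "u \<le> t"
    have "((\<lambda>t. K * (sn K t - t * cs K t)) has_real_derivative K\<^sup>2 * (u * sn K u)) (at u)"
      using K by (auto intro!: derivative_eq_intros simp: power2_eq_square algebra_simps)
    moreover have "K\<^sup>2 * (u * sn K u) \<ge> 0" using u t sn' by simp
    ultimately show "\<exists>y. ((\<lambda>t. K * (sn K t - t * cs K t)) has_real_derivative y) (at u) \<and> 0 \<le> y" by blast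
  qed
  then have "K * (sn K r - r * cs K r) / sn K r \<ge> 0" using r sn[of r] by simp
  then show "K * (1 - hess K r) \<ge> 0" using sn[of r] r by (simp add: hess_def field_simps)
  assume s: "0 < s" "s \<le> r"
  have cs: "K * (t - cs K t * sn K t) \<ge> K * (0 - cs K 0 * sn K 0)" if t: "0 \<le> t" "t \<le> r" for t
  proof (rule DERIV_nonneg_imp_nondecreasing[OF t(1)])
    fix u assume u: "0 \<le> u" "u \<le> t"
    have "((\<lambda>t. K * (t - cs K t * sn K t)) has_real_derivative K * (1 - ((cs K u)\<^sup>2 - K * (sn K u)\<^sup>2))) (at u)"
      using K by (auto intro!: derivative_eq_intros simp: power2_eq_square algebra_simps)
    moreover have "K * (1 - ((cs K u)\<^sup>2 - K * (sn K u)\<^sup>2)) = 2 * K\<^sup>2 * (sn K u)\<^sup>2"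
      using cs_sn_identity[OF K, of u] by algebra
    then have "K * (1 - ((cs K u)\<^sup>2 - K * (sn K u)\<^sup>2)) \<ge> 0" by simp
    ultimately show "\<exists>y. ((\<lambda>t. K * (t - cs K t * sn K t)) has_real_derivative y) (at u) \<and> 0 \<le> y" by blast
  qed
  have "K * hess K s \<ge> K * hess K r"
  proof (rule DERIV_nonpos_imp_nonincreasing[OF s(2)])
    fix t assume t: "s \<le> t" "t \<le> r"
    have snt: "sn K t > 0" using sn t s by simp
    have "(hess K has_real_derivative ((cs K t - t * (K * sn K t)) * sn K t - t * cs K t * cs K t) / (sn K t * sn K t)) (at t)"
      unfolding hess_def[abs_def] using K snt by (auto intro!: derivative_eq_intros)
    then have "((\<lambda>t. K * hess K t) has_real_derivative
        K * (((cs K t - t * (K * sn K t)) * sn K t - t * cs K t * cs K t) / (sn K t * sn K t))) (at t)"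
      by (rule DERIV_cmult)
    moreover have "(cs K t - t * (K * sn K t)) * sn K t - t * cs K t * cs K t = - (t - cs K t * sn K t)"
      using cs_sn_identity[OF K, of t] by algebra
    then have "K * (((cs K t - t * (K * sn K t)) * sn K t - t * cs K t * cs K t) / (sn K t * sn K t)) \<le> 0"
      using cs[of t] t s snt by (simp add: zero_le_mult_iff mult_le_0_iff divide_le_0_iff)
    ultimately show "\<exists>y. ((\<lambda>t. K * hess K t) has_real_derivative y) (at t) \<and> y \<le> 0" by blast
  qed
  then show "K * (hess K s - hess K r) \<ge> 0" by (simp add: algebra_simps)
qed

text \<open>Here \<open>h t\<close> is the cosine of the distance from \<open>x0\<close> to the point at time \<open>t\<close> of a unit speed geodesic
  that starts at distance \<open>a\<close> and does not run through \<open>x0\<close>; \<open>m = - sn K a\<close> would be the direction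
  straight away from \<open>x0\<close>.\<close>

lemma squared_distance_taylor:
  assumes K: "K \<noteq> 0" and a: "a > 0" "K > 0 \<Longrightarrow> a < pi / sqrt K" and d: "d > 0"
    and m: "m\<^sup>2 < (sn K a)\<^sup>2"
    and h_def: "h = (\<lambda>t. cs K t * cs K a + K * sn K t * m)"
    and h: "\<And>t. 0 \<le> t \<Longrightarrow> t \<le> d \<Longrightarrow> h t \<in> cs_range K"
    and b: "\<And>t. 0 \<le> t \<Longrightarrow> t \<le> d \<Longrightarrow> acs K (h t) \<le> r"
  obtains c s p where "(acs K (h d))\<^sup>2 / 2 = a\<^sup>2 / 2 - a / sn K a * m * d + c / 2 * d\<^sup>2"
    "0 < s" "s \<le> r" "0 \<le> p" "p \<le> 1" "c = p * 1 + (1 - p) * hess K s"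
proof -
  define h' where "h' = (\<lambda>t. K * (cs K t * m - sn K t * cs K a))"
  define b where "b = (\<lambda>t. acs K (h t))"
  define b' where "b' = (\<lambda>t. - h' t / (K * sn K (b t)))"
  have sna: "sn K a > 0" using sn_pos K a by simp
  have dh: "(h has_real_derivative h' t) (at t)" for t
    unfolding h_def h'_def using K by (auto intro!: derivative_eq_intros simp: algebra_simps)
  have dh': "(h' has_real_derivative - K * h t) (at t)" for t
    unfolding h_def h'_def using K by (auto intro!: derivative_eq_intros simp: algebra_simps)
  \<comment> \<open>Since h'' = - K h, the energy (h')^2 + K h^2 is conserved. Together with m^2 <
    (sn K a)^2 it keeps h away from 1 and - 1, where \<open>acs K\<close> is not
    differentiable.\<close>
  have e: "(h' t)\<^sup>2 + K * (h t)\<^sup>2 = K\<^sup>2 * m\<^sup>2 + K * (cs K a)\<^sup>2" for t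
    unfolding h_def h'_def using cs_sn_identity[OF K, of t] by algebra
  have energy: "K * (1 - (h t)\<^sup>2) = (h' t)\<^sup>2 + K\<^sup>2 * ((sn K a)\<^sup>2 - m\<^sup>2)" for t
    using e[of t] cs_sn_identity[OF K, of a] by algebra
  have "K\<^sup>2 * ((sn K a)\<^sup>2 - m\<^sup>2) > 0" using m K by simp
  then have pos: "K * (1 - (h t)\<^sup>2) > 0" for t
    unfolding energy by (intro add_nonneg_pos) auto
  have h1: "h t \<noteq> 1" "h t \<noteq> -1" for t
  proof -
    have "(h t)\<^sup>2 \<noteq> 1" using pos[of t] by (metis diff_self mult_zero_right less_irrefl)
    then show "h t \<noteq> 1" "h t \<noteq> -1" by auto
  qed
  have cs: "cs K (b t) = h t" if "0 \<le> t" "t \<le> d" for t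
    using cs_acs K h[OF that] by (simp add: b_def)
  have bpos: "b t > 0" if "0 \<le> t" "t \<le> d" for t
  proof -
    have "b t \<noteq> 0" using cs[OF that] h1(1)[of t] by (metis cs_0)
    then show ?thesis using acs_nonneg[OF K h[OF that]] by (simp add: b_def)
  qed
  have sn: "sn K (b t) > 0" if "0 \<le> t" "t \<le> d" for t
    using bpos[OF that] acs_less[OF _ h[OF that] h1(2)] by (intro sn_pos[OF K]) (auto simp: b_def)
  have db: "(b has_real_derivative b' t) (at t)" if "0 \<le> t" "t \<le> d" for t
    using DERIV_chain2[OF has_real_derivative_acs[OF K h[OF that] h1] dh]
    by (simp add: b_def[abs_def] b'_def)
  have b'2: "(b' t)\<^sup>2 \<le> 1" if "0 \<le> t" "t \<le> d" for t
  proof -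
    have "K * (1 - (h t)\<^sup>2) = (K * sn K (b t))\<^sup>2"
      using cs_sn_identity[OF K, of "b t"] cs[OF that] by algebra
    then have "(h' t)\<^sup>2 \<le> (K * sn K (b t))\<^sup>2"
      using energy[of t] \<open>K\<^sup>2 * ((sn K a)\<^sup>2 - m\<^sup>2) > 0\<close> by linarith
    then show ?thesis using K sn[OF that] by (simp add: b'_def power_divide divide_le_eq_1)
  qed
  define g' where "g' = (\<lambda>t. - (b t / sn K (b t)) * h' t / K)"
  \<comment> \<open>The Hessian in the direction of the geodesic: \<open>(b' t)\<^sup>2\<close> is
    the squared cosine of its angle with the radial direction, which has eigenvalue 1, and becomes
    the weight \<open>p\<close>.\<close>
  define g'' where "g'' = (\<lambda>t. (b' t)\<^sup>2 * 1 + (1 - (b' t)\<^sup>2) * hess K (b t))"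
  have d0: "((\<lambda>t. (b t)\<^sup>2 / 2) has_real_derivative g' t) (at t)" if "0 \<le> t" "t \<le> d" for t
    using DERIV_cdivide[OF DERIV_power[OF db[OF that], of 2], of 2] by (simp add: g'_def b'_def mult_ac)
  have d1: "(g' has_real_derivative g'' t) (at t)" if t: "0 \<le> t" "t \<le> d" for t
  proof -
    have "((\<lambda>t. b t / sn K (b t)) has_real_derivative
        (b' t * sn K (b t) - b t * (cs K (b t) * b' t)) / (sn K (b t) * sn K (b t))) (at t)"
      using sn[OF t] by (intro DERIV_divide has_real_derivative_sn[OF K] db t) auto
    then have "((\<lambda>t. - (b t / sn K (b t)) * h' t / K) has_real_derivative
        (- ((b' t * sn K (b t) - b t * (cs K (b t) * b' t)) / (sn K (b t) * sn K (b t))) * h' t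
         + - K * h t * - (b t / sn K (b t))) / K) (at t)"
      by (intro DERIV_cdivide DERIV_mult DERIV_minus dh')
    moreover have h': "h' t = - K * sn K (b t) * b' t" using K sn[OF t] by (simp add: b'_def)
    have "(- ((b' t * sn K (b t) - b t * (cs K (b t) * b' t)) / (sn K (b t) * sn K (b t))) * h' t
         + - K * h t * - (b t / sn K (b t))) / K = g'' t"
      unfolding h' g''_def hess_def cs[OF t] using K sn[OF t]
      by (simp add: power2_eq_square field_simps)
    ultimately show ?thesis
      unfolding g'_def by simp
  qed
  have "\<exists>t. 0 < t \<and> t < d \<and> (b d)\<^sup>2 / 2 = (\<Sum>k<2. (if k = 0 then \<lambda>t. (b t)\<^sup>2 / 2 else if k = 1 then g' else g'') 0 / fact k * (d - 0) ^ k)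
     + (if (2::nat) = 0 then \<lambda>t. (b t)\<^sup>2 / 2 else if (2::nat) = 1 then g' else g'') t / fact 2 * (d - 0) ^ 2"
    by (rule Taylor_up[where a = 0]) (use d d0 d1 in \<open>auto simp: less_2_cases_iff\<close>)
  then obtain t where t: "0 < t" "t < d" "(b d)\<^sup>2 / 2 = (b 0)\<^sup>2 / 2 + g' 0 * d + g'' t / 2 * d\<^sup>2"
    by (auto simp: numeral_2_eq_2)
  have "b 0 = a" using acs_cs[OF K, of a] a by (simp add: b_def h_def less_imp_le)
  then have g0: "g' 0 = - (a / sn K a * m)" using K by (simp add: g'_def h'_def)
  show ?thesis
  proof (rule that)
    show "(acs K (h d))\<^sup>2 / 2 = a\<^sup>2 / 2 - a / sn K a * m * d + g'' t / 2 * d\<^sup>2"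
      using t(3) g0 \<open>b 0 = a\<close> by (simp add: b_def)
    show "0 < b t" "b t \<le> r" using t bpos assms(8) by (simp_all add: b_def)
    show "0 \<le> (b' t)\<^sup>2" "(b' t)\<^sup>2 \<le> 1" using t b'2 by simp_all
    show "g'' t = (b' t)\<^sup>2 * 1 + (1 - (b' t)\<^sup>2) * hess K (b t)" by (simp add: g''_def)
  qed
qed

context space_ball
begin

text \<open>Geodesic convexity of the ball, needed to expand functions along the geodesic from x to
  y without leaving the ball.\<close>

lemma geodesic_segment:
  assumes "x \<in> B" "y \<in> B" "x \<noteq> y"
  obtains w where "w \<in> tangent K x" "form K w w = 1" "slog K x y = sdist K x y *\<^sub>R w"
    "y = cs K (sdist K x y) *\<^sub>R x + sn K (sdist K x y) *\<^sub>R w"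
    "\<And>t. 0 \<le> t \<Longrightarrow> t \<le> sdist K x y \<Longrightarrow> cs K t *\<^sub>R x + sn K t *\<^sub>R w \<in> B"
proof -
  define d where "d = sdist K x y"
  note sf = ball_space_form[OF assms(1)] ball_space_form[OF assms(2)]
  note na = ball_not_antipodal[OF assms(1,2)]
  have d: "d > 0" using sdist_eq_0_iff[OF K sf] sdist_nonneg[OF K sf] assms(3) by (simp add: d_def)
  define w where "w = (1 / d) *\<^sub>R slog K x y"
  have sl: "slog K x y = d *\<^sub>R w" using d by (simp add: w_def)
  have w: "w \<in> tangent K x" unfolding w_def by (intro tangent_scaleR slog_tangent[OF K sf na])
  have w1: "form K w w = 1"
    using form_slog[OF K sf na] d by (simp add: w_def form_simps d_def power2_eq_square)
  then have n: "tnorm K w = 1" by (simp add: tnorm_def)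
  have y: "y = cs K d *\<^sub>R x + sn K d *\<^sub>R w"
    using geod_slog[OF K sf na] d unfolding sl by (simp add: geod_def tnorm_scaleR n)
  have "cs K t *\<^sub>R x + sn K t *\<^sub>R w \<in> B" if t: "0 \<le> t" "t \<le> d" for t
  proof -
    define m where "m = form K x0 w"
    have sn: "sn K t \<ge> 0" if "0 \<le> t" "t \<le> d" for t
    proof (cases "t = 0")
      case False
      then have "t > 0" "K > 0 \<Longrightarrow> t < pi / sqrt K"
        using sdist_less[OF K sf na] that by (auto simp: d_def)
      then show ?thesis using sn_pos[OF K] less_imp_le by blast
    qed simp
    have snd: "sn K d > 0" using sn_sdist_pos[OF K sf na assms(3)] by (simp add: d_def)
    have hd: "cosd K x0 y = cs K d * cosd K x0 x + K * sn K d * m"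
      by (subst y) (simp add: cosd_def form_simps m_def algebra_simps)
    have ht: "cosd K x0 (cs K t *\<^sub>R x + sn K t *\<^sub>R w) = cs K t * cosd K x0 x + K * sn K t * m"
      by (simp add: cosd_def form_simps m_def algebra_simps)
    have dt: "sn K d = sn K (d - t) * cs K t + cs K (d - t) * sn K t"
      using sn_add[OF K, of "d - t" t] by simp
    \<comment> \<open>A solution of f'' = - K f is interpolated from its end values: the weights at
      0 and d are \<open>sn K (d - t)\<close> and \<open>sn K t\<close>, over
      \<open>sn K d\<close>.\<close>
    have "sn K d * cosd K x0 (cs K t *\<^sub>R x + sn K t *\<^sub>R w) = sn K (d - t) * cosd K x0 x + sn K t * cosd K x0 y"
      unfolding hd ht sn_diff[OF K] by (simp add: algebra_simps)
    then have "sn K d * (K * (cosd K x0 (cs K t *\<^sub>R x + sn K t *\<^sub>R w) - cs K R)) =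
      K * (sn K (d - t) * cosd K x0 x + sn K t * cosd K x0 y) - K * cs K R * sn K d"
      by (simp add: algebra_simps)
    \<comment> \<open>By \<open>dt\<close>, K times the excess of the two weights over
      \<open>sn K d\<close> is the last bracket, whose terms are nonnegative by
      \<open>cs_le_1\<close>.\<close>
    also have "\<dots> =
      sn K (d - t) * (K * (cosd K x0 x - cs K R)) + sn K t * (K * (cosd K x0 y - cs K R))
      + cs K R * (sn K (d - t) * (K * (1 - cs K t)) + sn K t * (K * (1 - cs K (d - t))))"
      by (subst dt) (simp add: algebra_simps)
    also have "\<dots> \<ge> 0"
    proof -
      have "sn K t \<ge> 0" "sn K (d - t) \<ge> 0" "cs K R \<ge> 0" using sn[of t] sn[of "d - t"] t cs_R by auto
      moreover have "K * (cosd K x0 x - cs K R) \<ge> 0" "K * (cosd K x0 y - cs K R) \<ge> 0"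
        using assms(1,2) unfolding mem_ball_cosd by blast+
      ultimately show ?thesis
        by - (assumption | rule cs_le_1 add_nonneg_nonneg mult_nonneg_nonneg)+
    qed
    finally have "K * (cosd K x0 (cs K t *\<^sub>R x + sn K t *\<^sub>R w) - cs K R) \<ge> 0"
      using snd by (simp add: zero_le_mult_iff)
    moreover have "cs K t *\<^sub>R x + sn K t *\<^sub>R w \<in> space_form K"
      using geod_in_space_form[OF K sf(1) w, of t] by (simp add: geod_def n)
    ultimately show ?thesis by (simp add: mem_ball_cosd)
  qed
  then show ?thesis by (rule that[OF w w1 sl[unfolded d_def] y[unfolded d_def], folded d_def])
qed

end

section \<open>The condition number\<close>

text \<open>Two vectors of the plane orthogonal to the same nonzero vector are proportional, so
  Cauchy-Schwarz is an equality. Applied to the velocity and the direction of \<open>x0\<close>,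
  this makes every geodesic radial in dimension one.\<close>

lemma form_dim_1:
  fixes x v w :: "'a::euclidean_space \<times> real"
  assumes "DIM('a) = 1" and K: "K \<noteq> 0" and x: "x \<in> space_form K"
    and v: "v \<in> tangent K x" and w: "w \<in> tangent K x"
  shows "(form K v w)\<^sup>2 = form K v v * form K w w"
proof -
  obtain e :: 'a where e: "Basis = {e}" using assms(1) by (auto simp: card_1_singleton_iff)
  have coord: "z = (z \<bullet> e) *\<^sub>R e" for z :: 'a using euclidean_representation[of z] by (simp add: e)
  have inner: "y \<bullet> z = (y \<bullet> e) * (z \<bullet> e)" for y z :: 'a by (subst (1) coord[of z]) simp
  define p q s t s' t' where pq: "p = fst x \<bullet> e" "q = snd x" "s = fst v \<bullet> e" "t = snd v" "s' = fst w \<bullet> e" "t' = snd w"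
  have f: "form K y z = (fst y \<bullet> e) * (fst z \<bullet> e) + sgn K * (snd y * snd z)" for y z :: "'a \<times> real"
    by (simp add: form_def inner[of "fst y" "fst z"])
  have s2: "(sgn K)\<^sup>2 = 1" using K by (simp add: power2_eq_square sgn_real_def)
  have 1: "p * s + sgn K * (q * t) = 0" "p * s' + sgn K * (q * t') = 0"
    using tangentD[OF v] tangentD[OF w] by (simp_all add: f pq)
  have "p * (s * t' - t * s') = 0" "q * (s * t' - t * s') = 0"
    using 1 s2 by algebra+
  moreover have "p \<noteq> 0 \<or> q \<noteq> 0" using space_form_self[OF x] K by (auto simp: f pq)
  ultimately have "s * t' - t * s' = 0" by auto
  then have "(s * s' + sgn K * (t * t'))\<^sup>2 = (s * s + sgn K * (t * t)) * (s' * s' + sgn K * (t' * t'))"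
    using s2 by algebra
  then show ?thesis by (simp add: f pq)
qed

text \<open>For x = (p, q), \<open>u1\<close> lies in the plane of p and the last axis, as (|p|, q)
  turned by a right angle in the sense of the form, and \<open>u2 = (e', 0)\<close> is orthogonal to
  that plane. If p = 0, a basis vector replaces its direction; in dimension one \<open>e'\<close> is
  0.\<close>

lemma orthonormal_tangents:
  fixes x :: "'a::euclidean_space \<times> real"
  assumes K: "K \<noteq> 0" and x: "x \<in> space_form K"
  obtains u1 u2 where "u1 \<in> tangent K x" "u2 \<in> tangent K x" "form K u1 u1 = 1" "form K u1 u2 = 0"
    "DIM('a) \<ge> 2 \<Longrightarrow> form K u2 u2 = 1"
proof -
  define p q where pq: "p = fst x" "q = snd x"
  obtain b :: 'a where b: "b \<in> Basis" using nonempty_Basis by blast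
  define e where "e = (if p = 0 then b else p /\<^sub>R norm p)"
  have e: "e \<bullet> e = 1" "p \<bullet> e = norm p"
    using b by (auto simp: e_def dot_square_norm power2_eq_square field_simps)
  obtain e' :: 'a where e': "e \<bullet> e' = 0" "p \<bullet> e' = 0" "DIM('a) \<ge> 2 \<Longrightarrow> e' \<bullet> e' = 1"
  proof (cases "DIM('a) \<ge> 2")
    case True
    then obtain y where y: "y \<noteq> 0" "orthogonal e y" using orthogonal_to_vector_exists by blast
    have "p = norm p *\<^sub>R e" by (simp add: e_def)
    then have "p \<bullet> y = norm p * (e \<bullet> y)" by (metis inner_scaleR_left)
    then have "p \<bullet> y = 0" using y by (simp add: orthogonal_def)
    then show ?thesis using y that[of "y /\<^sub>R norm y"]
      by (simp add: orthogonal_def dot_square_norm power2_eq_square)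
  next
    case False
    then show ?thesis using that[of 0] by simp
  qed
  have s2: "sgn K * sgn K = 1" "sgn K * \<bar>K\<bar> = K" using K by (simp_all add: sgn_real_def)
  have n: "(norm p)\<^sup>2 + sgn K * q\<^sup>2 = 1 / K"
    using space_form_self[OF x] unfolding power2_norm_eq_inner
    by (simp add: form_def pq power2_eq_square)
  define k where "k = sqrt \<bar>K\<bar>"
  have k: "k * k = \<bar>K\<bar>" by (simp add: k_def)
  define u1 where "u1 = k *\<^sub>R (- (sgn K * q) *\<^sub>R e, norm p)"
  have "form K u1 u1 = k * k * ((sgn K * sgn K) * q\<^sup>2 + sgn K * (norm p)\<^sup>2)"
    by (simp add: u1_def form_def e power2_eq_square algebra_simps)
  also have "\<dots> = \<bar>K\<bar> * (sgn K * ((norm p)\<^sup>2 + sgn K * q\<^sup>2))"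
    unfolding k using s2(1) by algebra
  also have "\<dots> = 1" unfolding n using s2(2) K by (simp add: mult.commute)
  finally have "form K u1 u1 = 1" .
  moreover have "form K x u1 = 0"
    by (simp add: u1_def form_def e flip: pq)
  moreover have "form K x (e', 0) = 0" "form K u1 (e', 0) = 0" "DIM('a) \<ge> 2 \<Longrightarrow> form K (e', 0) (e', 0) = 1"
    using e' by (simp_all add: form_def u1_def flip: pq)
  ultimately show ?thesis using that[of u1 "(e', 0)"] by (auto intro: tangentI)
qed

lemma form_le_norm: "form K v v \<le> (norm v)\<^sup>2"
proof -
  have "sgn K * (snd v * snd v) \<le> 1 * (snd v * snd v)" by (intro mult_right_mono) (auto simp: sgn_real_def)
  then show ?thesis by (simp add: form_def power2_norm_eq_inner inner_prod_def)
qed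

lemma has_derivative_quadratic:
  assumes "eventually (\<lambda>y. \<bar>f y - f x\<bar> \<le> C * (norm (y - x))\<^sup>2) (at x within S)"
  shows "(f has_derivative (\<lambda>_. 0 :: real)) (at x within S)"
proof -
  obtain e where e: "e > 0" "\<And>y. y \<in> S \<Longrightarrow> y \<noteq> x \<Longrightarrow> dist y x < e \<Longrightarrow> \<bar>f y - f x\<bar> \<le> C * (norm (y - x))\<^sup>2"
    using assms unfolding eventually_at by metis
  show ?thesis
  proof (rule has_derivativeI_sandwich[OF e(1)])
    show "((\<lambda>y. C * norm (y - x)) \<longlongrightarrow> 0) (at x within S)"
      by (auto intro!: tendsto_eq_intros)
    fix y assume "y \<in> S" "y \<noteq> x" "dist y x < e"
    then show "norm ((f y - f x) - 0) / norm (y - x) \<le> C * norm (y - x)"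
      using e(2)[of y] by (simp add: pos_divide_le_eq power2_eq_square)
  qed simp
qed

section \<open>Expansion and gradient of half the squared distance on the ball\<close>

context space_ball
begin

lemma ball_dist_less: "p \<in> B \<Longrightarrow> K > 0 \<Longrightarrow> sdist K x0 p < pi / (2 * sqrt K)"
  using R_less by (auto simp: mem_ball)

text \<open>If the geodesic from x to y is radial, the distance to \<open>x0\<close> is |a - d| or a
  + d at its end, and c = 1. Otherwise \<open>squared_distance_taylor\<close> makes c a convex
  combination of 1 and \<open>hess K s\<close> with s at most R.\<close>

lemma half_square_expansion:
  assumes x: "x \<in> B" and y: "y \<in> B"
  obtains c where "(sdist K y x0)\<^sup>2 / 2 = (sdist K x x0)\<^sup>2 / 2 + form K (- slog K x x0) (slog K x y) + c / 2 * (sdist K x y)\<^sup>2"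
    "K * (1 - c) \<ge> 0" "K * (c - hess K R) \<ge> 0" "DIM('a) = 1 \<Longrightarrow> c = 1"
proof (cases "x = y")
  case True
  then show ?thesis
    using that[of 1] hess_le_1[OF K R R_less_pi] sdist_self[OF K ball_space_form[OF y]]
    by (simp add: slog_def form.zero_right)
next
  case False
  note sf = ball_space_form[OF x] ball_space_form[OF y]
  note na = ball_not_antipodal[OF x y]
  obtain w where w: "w \<in> tangent K x" "form K w w = 1" "slog K x y = sdist K x y *\<^sub>R w"
    "y = cs K (sdist K x y) *\<^sub>R x + sn K (sdist K x y) *\<^sub>R w"
    "\<And>t. 0 \<le> t \<Longrightarrow> t \<le> sdist K x y \<Longrightarrow> cs K t *\<^sub>R x + sn K t *\<^sub>R w \<in> B"
    using geodesic_segment[OF x y False] by metis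
  define a d m where adm: "a = sdist K x0 x" "d = sdist K x y" "m = form K x0 w"
  define h where "h = (\<lambda>t. cs K t * cs K a + K * sn K t * m)"
  have a: "a \<ge> 0" "K > 0 \<Longrightarrow> a < pi / sqrt K"
    using sdist_nonneg[OF K x0 sf(1)] x R_less_pi by (auto simp: adm mem_ball)
  have d: "d > 0" "K > 0 \<Longrightarrow> d < pi / sqrt K"
    using sdist_nonneg[OF K sf] sdist_eq_0_iff[OF K sf] sdist_less[OF K sf na] False by (auto simp: adm)
  have csa: "cs K a = cosd K x0 x" using cs_sdist[OF K x0 sf(1)] by (simp add: adm)
  have h: "h t = cosd K x0 (cs K t *\<^sub>R x + sn K t *\<^sub>R w)" for t
    unfolding h_def csa by (simp add: cosd_def form_simps adm algebra_simps)
  have hd: "h d = cosd K x0 y" unfolding h adm(2) w(4)[symmetric] ..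
  have b: "acs K (h d) = sdist K y x0" unfolding hd by (simp add: sdist_def cosd_commute)
  have h_ball: "h t \<in> cs_range K" "acs K (h t) \<le> R" if "0 \<le> t" "t \<le> d" for t
    using w(5)[OF that[unfolded adm]] cosd_in_range[OF K x0] unfolding h by (auto simp: mem_ball sdist_def)
  have normal: "form K w (x0 - cosd K x x0 *\<^sub>R x) = m"
    using tangentD[OF w(1)] by (simp add: form_simps adm form_commute[of K w])
  have form_eq: "form K (- slog K x x0) (slog K x y) = - (a / sn K a * m * d)"
    unfolding w(3) slog_def[of K x x0] using normal
    by (simp add: form_simps form_commute[of K _ w] sdist_commute[of K x] adm)
  have norm: "form K (x0 - cosd K x x0 *\<^sub>R x) (x0 - cosd K x x0 *\<^sub>R x) = (sn K a)\<^sup>2"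
    unfolding form_normal_part[OF K sf(1) x0] using cs_sn_identity[OF K, of a] K
    by (simp add: csa cosd_commute[of K x] field_simps)
  note nt = normal_part_tangent[OF K sf(1) x0]
  have m: "m\<^sup>2 \<le> (sn K a)\<^sup>2" "DIM('a) = 1 \<Longrightarrow> m\<^sup>2 = (sn K a)\<^sup>2"
    using form_cauchy_schwarz[OF K sf(1) w(1) nt] form_dim_1[OF _ K sf(1) w(1) nt]
    by (simp_all add: normal norm w(2))
  show ?thesis
  proof (cases "m\<^sup>2 = (sn K a)\<^sup>2")
    case True
    have "(sdist K y x0)\<^sup>2 / 2 = a\<^sup>2 / 2 - a / sn K a * m * d + 1 / 2 * d\<^sup>2"
    proof (cases "m = sn K a")
      case True
      then have "h d = cs K \<bar>a - d\<bar>" by (simp add: h_def cs_diff[OF K] abs_if mult_ac)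
      then have "sdist K y x0 = \<bar>a - d\<bar>"
        using a d unfolding b[symmetric] by (auto simp: abs_if intro!: acs_cs[OF K])
      moreover have "a / sn K a * m = a"
        using sn_pos[OF K, of a] a True by (cases "a = 0") auto
      ultimately show ?thesis by (simp add: power2_diff field_simps)
    next
      case False
      then have ma: "m = - sn K a" using \<open>m\<^sup>2 = (sn K a)\<^sup>2\<close> by (simp add: power2_eq_iff)
      then have hd': "h d = cs K (a + d)" by (simp add: h_def cs_add[OF K] mult_ac)
      \<comment> \<open>Otherwise the geodesic from x away from \<open>x0\<close> has passed the
        antipode of \<open>x0\<close>, by a length t less than pi / (2 sqrt K). Then
        \<open>cosd K x0 y\<close> is - cs t, which is negative and excludes y from the
        ball.\<close>
      have "a + d \<le> pi / sqrt K" if "K > 0"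
      proof (rule ccontr)
        assume "\<not> a + d \<le> pi / sqrt K"
        define t where "t = a + d - pi / sqrt K"
        have "a < pi / (2 * sqrt K)" using ball_dist_less[OF x that] by (simp add: adm)
        then have "cs K t > 0" using \<open>\<not> a + d \<le> pi / sqrt K\<close> d(2) that
          by (intro cs_pos[OF K]) (auto simp: t_def)
        moreover have "cs K (t + pi / sqrt K) = - cs K t"
          using that by (simp add: cs_def distrib_left)
        ultimately have "h d < 0" unfolding hd' by (simp add: t_def)
        then show False using ball_cosd_pos[OF y] hd by simp
      qed
      then have "sdist K y x0 = a + d"
        using a d unfolding b[symmetric] hd' by (intro acs_cs[OF K]) auto
      moreover have "a > 0" using False ma a by (cases "a = 0") auto
      then have "a / sn K a * m = - a"
        using sn_pos[OF K, of a] a ma by simp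
      ultimately show ?thesis by (simp add: power2_sum field_simps)
    qed
    then show ?thesis
      using that[of 1] hess_le_1[OF K R R_less_pi] by (simp add: form_eq sdist_commute[of K x x0] adm)
  next
    case False
    then have m': "m\<^sup>2 < (sn K a)\<^sup>2" using m by simp
    then have "a \<noteq> 0" by auto
    then have "a > 0" using a by simp
    then obtain c s p where c: "(acs K (h d))\<^sup>2 / 2 = a\<^sup>2 / 2 - a / sn K a * m * d + c / 2 * d\<^sup>2"
      "0 < s" "s \<le> R" "0 \<le> p" "p \<le> 1" "c = p * 1 + (1 - p) * hess K s"
      using squared_distance_taylor[OF K _ a(2) d(1) m' h_def h_ball] by metis
    have s: "K > 0 \<Longrightarrow> s < pi / sqrt K" using c R_less_pi by force
    have "K * (1 - c) = (1 - p) * (K * (1 - hess K s))" unfolding c(6) by (simp add: algebra_simps)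
    also have "\<dots> \<ge> 0" using c(5) hess_le_1[OF K c(2) s] by (intro mult_nonneg_nonneg[of "1 - p"]) auto
    finally have 1: "K * (1 - c) \<ge> 0" .
    have "K * (c - hess K R) = p * (K * (1 - hess K R)) + (1 - p) * (K * (hess K s - hess K R))"
      unfolding c(6) by (simp add: algebra_simps)
    also have "\<dots> \<ge> 0"
      using c(4,5) hess_le_1[OF K R R_less_pi] hess_antimono[OF K R R_less_pi c(2,3)]
      by (intro add_nonneg_nonneg mult_nonneg_nonneg[of p] mult_nonneg_nonneg[of "1 - p"]) auto
    finally have "K * (c - hess K R) \<ge> 0" .
    moreover have "(sdist K y x0)\<^sup>2 / 2 = (sdist K x x0)\<^sup>2 / 2 + form K (- slog K x x0) (slog K x y) + c / 2 * (sdist K x y)\<^sup>2"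
      using c(1) unfolding b form_eq by (simp add: sdist_commute[of K x x0] adm(1,2))
    ultimately show ?thesis using that 1 m(2) False by blast
  qed
qed

text \<open>Derivatives within M see only directions inside M, so the ball has to supply enough of
  them. Geodesics from x to points y of the ball give \<open>form K z y = 0\<close> for the
  difference z of the gradients. With y = \<open>x0\<close>, z is tangent at \<open>x0\<close>; the
  point at distance R from \<open>x0\<close> in direction z then forces z = 0.\<close>

lemma gradient_unique:
  assumes M: "B \<subseteq> M" and x: "x \<in> B" and g: "is_gradient K M F x g1" "is_gradient K M F x g2"
  shows "g1 = g2"
proof -
  obtain D1 D2 where D: "(F has_derivative D1) (at x within M)" "(F has_derivative D2) (at x within M)"
    and D1: "\<And>v. v \<in> tangent K x \<Longrightarrow> D1 v = form K g1 v"
    and D2: "\<And>v. v \<in> tangent K x \<Longrightarrow> D2 v = form K g2 v"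
    and gt: "g1 \<in> tangent K x" "g2 \<in> tangent K x"
    using g unfolding is_gradient_def by metis
  define z where "z = g1 - g2"
  have zx: "form K z x = 0" using gt by (simp add: z_def form_simps tangent_def form_commute[of K _ x])
  have z: "form K z y = 0" if y: "y \<in> B" for y
  proof (cases "x = y")
    case False
    obtain w where w: "w \<in> tangent K x"
      "y = cs K (sdist K x y) *\<^sub>R x + sn K (sdist K x y) *\<^sub>R w"
      "\<And>t. 0 \<le> t \<Longrightarrow> t \<le> sdist K x y \<Longrightarrow> cs K t *\<^sub>R x + sn K t *\<^sub>R w \<in> B"
      using geodesic_segment[OF x y False] by metis
    define d where "d = sdist K x y"
    note sf = ball_space_form[OF x] ball_space_form[OF y]
    have d: "d > 0" using sdist_nonneg[OF K sf] sdist_eq_0_iff[OF K sf] False by (simp add: d_def)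
    define \<gamma> where "\<gamma> = (\<lambda>t. cs K t *\<^sub>R x + sn K t *\<^sub>R w)"
    have \<gamma>: "(\<gamma> has_derivative (\<lambda>h. h *\<^sub>R w)) (at 0 within {0..d})"
      unfolding \<gamma>_def has_vector_derivative_def[symmetric] using K
      by (auto intro!: derivative_eq_intros)
    have \<gamma>M: "\<gamma> ` {0..d} \<subseteq> M" "\<gamma> 0 = x" using M w(3) by (auto simp: \<gamma>_def d_def)
    have "((\<lambda>t. F (\<gamma> t)) has_vector_derivative D w) (at 0 within {0..d})"
      if "(F has_derivative D) (at x within M)" for D
    proof -
      have "((\<lambda>t. F (\<gamma> t)) has_derivative (\<lambda>h. D (h *\<^sub>R w))) (at 0 within {0..d})"
        using that \<gamma>M by (intro has_derivative_in_compose[OF \<gamma>]) (auto intro: has_derivative_subset)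
      then show ?thesis
        using has_derivative_linear[OF that] by (simp add: has_vector_derivative_def linear_scale)
    qed
    from this[OF D(1)] this[OF D(2)] have "D1 w = D2 w"
      using d by (intro vector_derivative_unique_within) (auto simp: trivial_limit_within islimpt_Icc)
    then have "form K z w = 0" using D1[OF w(1)] D2[OF w(1)] by (simp add: z_def form_simps)
    then show ?thesis by (subst w(2)) (simp add: form_simps zx)
  qed (use zx in simp)
  then have zt: "z \<in> tangent K x0" using center_mem_ball by (simp add: tangent_def form_commute)
  have "z = 0"
  proof (rule ccontr)
    assume "z \<noteq> 0"
    then have fz: "form K z z > 0" using form_tangent_pos[OF K x0 zt] by simp
    define n where "n = tnorm K z"
    have n: "n > 0" using fz by (simp add: n_def tnorm_def)
    define v where "v = (R / n) *\<^sub>R z"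
    have v: "v \<in> tangent K x0" "tnorm K v = R"
      using zt n R by (auto simp: v_def tangent_scaleR tnorm_scaleR simp flip: n_def)
    then have "rexp K x0 v \<in> B" by (auto simp: geo_ball_def)
    then have "form K z (geod K x0 v 1) = 0" using z rexp_eq[OF K x0 v(1)] by simp
    then have "sn K R / R * form K z v = 0"
      using tangentD[OF zt] v(2) by (simp add: geod_def form_simps form_commute[of K z x0])
    moreover have "form K z v = R / n * form K z z" by (simp add: v_def form_simps)
    ultimately show False using fz n R sn_R by simp
  qed
  then show ?thesis by (simp add: z_def)
qed

text \<open>M may contain the antipode of \<open>x0\<close>, about which \<open>rdist_eq\<close>
  says nothing. Near x, \<open>cosd K x0\<close> stays positive, which avoids it.\<close>

lemma eventually_rdist:
  assumes M: "M \<subseteq> space_form K" and x: "x \<in> B"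
  shows "eventually (\<lambda>y. rdist K y x0 = sdist K x0 y) (at x within M)"
proof -
  have "((\<lambda>y. cosd K x0 y) \<longlongrightarrow> cosd K x0 x) (at x within M)"
    unfolding cosd_def by (intro tendsto_intros bounded_linear.tendsto[OF form.bounded_linear_right])
  then have "eventually (\<lambda>y. cosd K x0 y > 0) (at x within M)"
    using ball_cosd_pos[OF x] by (rule order_tendstoD)
  moreover have "eventually (\<lambda>y. y \<in> M) (at x within M)" by (simp add: eventually_at_filter)
  ultimately show ?thesis
  proof eventually_elim
    case (elim y)
    then have "y \<in> space_form K" "cosd K y x0 \<noteq> -1" using M by (auto simp: cosd_commute[of K y])
    then show ?case using rdist_eq[OF K _ x0, of y] by (simp add: sdist_commute[of K x0])
  qed
qed

lemma sn_half_bound: "eventually (\<lambda>h. \<bar>h\<bar> \<le> 2 * \<bar>sn K h\<bar>) (nhds 0)"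
proof -
  have "((\<lambda>h. sn K h / h) \<longlongrightarrow> 1) (at 0)"
    using has_real_derivative_sn[OF K DERIV_ident, of 0 UNIV] by (simp add: DERIV_def)
  then have "eventually (\<lambda>h. sn K h / h > 1 / 2) (at 0)" by (rule order_tendstoD) simp
  then have "eventually (\<lambda>h. h \<noteq> 0 \<longrightarrow> sn K h / h > 1 / 2) (nhds 0)" by (simp add: eventually_at_filter)
  then show ?thesis
  proof (rule eventually_mono)
    fix h assume *: "h \<noteq> 0 \<longrightarrow> sn K h / h > 1 / 2"
    show "\<bar>h\<bar> \<le> 2 * \<bar>sn K h\<bar>"
    proof (cases "h = 0")
      case False
      then have "\<bar>sn K h / h\<bar> > 1 / 2" using * by linarith
      then show ?thesis using False by (simp add: abs_divide field_simps)
    qed simp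
  qed
qed

lemma gradient_half_square:
  assumes M: "B \<subseteq> M" "M \<subseteq> space_form K" and x: "x \<in> B"
  shows "is_gradient K M (\<lambda>y. (rdist K y x0)\<^sup>2 / 2) x (- slog K x x0)"
proof -
  note sf = ball_space_form[OF x]
  have xM: "x \<in> M" using M x by auto
  have tan: "- slog K x x0 \<in> tangent K x"
    by (intro tangent_minus slog_tangent[OF K sf x0] ball_not_antipodal x center_mem_ball)
  have rx: "rdist K x x0 = sdist K x0 x"
    using ball_rdist[OF x center_mem_ball] by (simp add: sdist_commute)
  have transfer: "((\<lambda>y. (rdist K y x0)\<^sup>2 / 2) has_derivative D) (at x within M)"
    if "((\<lambda>y. (sdist K x0 y)\<^sup>2 / 2) has_derivative D) (at x within M)" for D
    by (rule has_derivative_transform_eventually[OF that])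
       (use eventually_rdist[OF M(2) x] rx xM in \<open>auto elim: eventually_mono\<close>)
  show ?thesis
  proof (cases "x = x0")
    case True
    \<comment> \<open>At the centre the chain rule fails, because \<open>acs K\<close> is not
      differentiable at 1. The derivative 0 comes from a quadratic bound instead.\<close>
    have lim: "((\<lambda>y. cosd K x0 y) \<longlongrightarrow> cosd K x0 x0) (at x0 within M)"
      unfolding cosd_def by (intro tendsto_intros bounded_linear.tendsto[OF form.bounded_linear_right])
    then have "((\<lambda>y. acs K (cosd K x0 y)) \<longlongrightarrow> acs K (cosd K x0 x0)) (at x0 within M)"
      using cosd_in_range[OF K x0] M(2) x0
      by (intro continuous_on_tendsto_compose[OF continuous_on_acs[OF K] lim]) (auto simp: eventually_at_filter intro!: always_eventually)
    then have "((\<lambda>y. sdist K x0 y) \<longlongrightarrow> 0) (at x0 within M)"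
      by (simp add: sdist_def cosd_self[OF K x0])
    then have "((\<lambda>y. sdist K x0 y / 2) \<longlongrightarrow> 0) (at x0 within M)" by (auto intro: tendsto_eq_intros)
    then have "eventually (\<lambda>y. \<bar>sdist K x0 y / 2\<bar> \<le> 2 * \<bar>sn K (sdist K x0 y / 2)\<bar>) (at x0 within M)"
      by (rule eventually_compose_filterlim[OF sn_half_bound])
    moreover have "eventually (\<lambda>y. y \<in> M) (at x0 within M)" by (simp add: eventually_at_filter)
    ultimately have "eventually (\<lambda>y. \<bar>(sdist K x0 y)\<^sup>2 / 2 - (sdist K x0 x0)\<^sup>2 / 2\<bar> \<le> 2 * (norm (y - x0))\<^sup>2) (at x0 within M)"
    proof eventually_elim
      case (elim y)
      define d where "d = sdist K x0 y"
      have y: "y \<in> space_form K" using elim M by auto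
      have "(d / 2)\<^sup>2 \<le> (2 * sn K (d / 2))\<^sup>2"
        using elim(1) unfolding abs_le_square_iff[symmetric] by (simp add: d_def abs_mult)
      \<comment> \<open>Four times the square of \<open>sn K (d / 2)\<close> is the square, in the
        form, of the ambient chord from \<open>x0\<close> to y.\<close>
      also have "\<dots> = 2 * (1 - cs K d) / K"
        using cs_double[OF K, of "d / 2"] K by (simp add: power_mult_distrib)
      also have "\<dots> = form K (y - x0) (y - x0)"
        using cs_sdist[OF K x0 y] K
        by (simp add: d_def form_simps space_form_self[OF y] space_form_self[OF x0] form_commute[of K y x0] cosd_def field_simps)
      also have "\<dots> \<le> (norm (y - x0))\<^sup>2" by (rule form_le_norm)
      finally show ?case by (simp add: sdist_self[OF K x0] power_divide d_def)
    qed
    then have "((\<lambda>y. (sdist K x0 y)\<^sup>2 / 2) has_derivative (\<lambda>_. 0)) (at x0 within M)"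
      by (rule has_derivative_quadratic)
    moreover have "slog K x x0 = 0" using True by (simp add: slog_def sdist_self[OF K x0])
    ultimately show ?thesis
      using tan transfer True by (auto simp: is_gradient_def form.zero_left)
  next
    case False
    define a where "a = sdist K x0 x"
    define D where "D = (\<lambda>v. K * form K x0 v * (a * (- 1 / (K * sn K a))))"
    have ne: "cosd K x0 x \<noteq> 1" "cosd K x0 x \<noteq> -1"
      using cosd_eq_1_iff[OF K x0 sf] False ball_cosd_pos[OF x] by auto
    have "(acs K has_real_derivative - 1 / (K * sn K a)) (at (cosd K x0 x))"
      using has_real_derivative_acs[OF K cosd_in_range[OF K x0 sf] ne] by (simp add: a_def sdist_def)
    from DERIV_cdivide[OF DERIV_power[OF this, of 2], of 2]
    have "((\<lambda>s. (acs K s)\<^sup>2 / 2) has_real_derivative a * (- 1 / (K * sn K a))) (at (cosd K x0 x))"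
      by (simp add: a_def sdist_def mult.commute)
    moreover have "((\<lambda>y. cosd K x0 y) has_derivative (\<lambda>v. K * form K x0 v)) (at x within M)"
      unfolding cosd_def
      by (intro has_derivative_mult_right bounded_linear.has_derivative[OF form.bounded_linear_right] has_derivative_ident)
    ultimately have "((\<lambda>y. (sdist K x0 y)\<^sup>2 / 2) has_derivative D) (at x within M)"
      unfolding sdist_def D_def has_field_derivative_def
      by (rule has_derivative_compose[rotated, where g = "\<lambda>s. (acs K s)\<^sup>2 / 2", THEN has_derivative_eq_rhs]) (auto simp: mult.commute)
    moreover have "D v = form K (- slog K x x0) v" if "v \<in> tangent K x" for v
      using tangentD[OF that] K
      by (simp add: D_def slog_def form_simps sdist_commute[of K x x0] flip: a_def)
    ultimately show ?thesis unfolding is_gradient_def using tan transfer by blast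
  qed
qed

lemma rgrad_half_square:
  assumes "B \<subseteq> M" "M \<subseteq> space_form K" "x \<in> B"
  shows "rgrad K M (\<lambda>y. (rdist K y x0)\<^sup>2 / 2) x = - slog K x x0"
  unfolding rgrad_def
  using gradient_half_square[OF assms]
  by (rule the_equality) (rule gradient_unique[OF assms(1,3) _ gradient_half_square[OF assms]])

section \<open>Comparison of the condition numbers\<close>

lemma smooth_fun_on_ball:
  "smooth_fun_on K M B F L \<longleftrightarrow>
    (\<forall>x\<in>B. \<forall>y\<in>B. F y \<le> F x + form K (rgrad K M F x) (slog K x y) + L / 2 * (sdist K x y)\<^sup>2)"
  unfolding smooth_fun_on_def by (simp add: ball_rlog ball_rdist)

lemma strongly_gconvex_on_ball:
  "strongly_gconvex_on K M B F \<mu> \<longleftrightarrow>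
    (\<forall>x\<in>B. \<forall>y\<in>B. F y \<ge> F x + form K (rgrad K M F x) (slog K x y) + \<mu> / 2 * (sdist K x y)\<^sup>2)"
  unfolding strongly_gconvex_on_def by (simp add: ball_rlog ball_rdist)

text \<open>From \<open>x0\<close> to a point at distance R > 0, the two inequalities share their
  value and gradient terms, which leaves the quadratic ones.\<close>

lemma convex_le_smooth:
  assumes "smooth_fun_on K M B F L" "strongly_gconvex_on K M B F \<mu>"
  shows "\<mu> \<le> L"
proof -
  obtain u1 where u: "u1 \<in> tangent K x0" "form K u1 u1 = 1"
    using orthonormal_tangents[OF K x0] by metis
  define y where "y = rexp K x0 (R *\<^sub>R u1)"
  have t: "R *\<^sub>R u1 \<in> tangent K x0" "tnorm K (R *\<^sub>R u1) = R"
    using u R by (auto simp: tangent_scaleR tnorm_scaleR) (simp add: tnorm_def)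
  then have y: "y \<in> B" by (auto simp: y_def geo_ball_def)
  have "sdist K x0 y = R"
    unfolding y_def rexp_eq[OF K x0 t(1)] sdist_def cosd_geod[OF K x0 t(1)] t(2)
    using R R_less_pi by (simp add: acs_cs[OF K] less_imp_le)
  then have "\<mu> / 2 * R\<^sup>2 \<le> L / 2 * R\<^sup>2"
    using assms center_mem_ball y unfolding smooth_fun_on_ball strongly_gconvex_on_ball by force
  then show ?thesis using R by simp
qed

lemma smooth_convex_hess:
  assumes "DIM('a) \<ge> 2" "smooth_fun_on K M B F L" "strongly_gconvex_on K M B F \<mu>"
  shows "\<mu> * hess K R \<le> L" "\<mu> \<le> L * hess K R"
proof -
  obtain u1 u2 where "u1 \<in> tangent K x0" "u2 \<in> tangent K x0" "form K u1 u1 = 1" "form K u1 u2 = 0"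
    "form K u2 u2 = 1"
    using orthonormal_tangents[OF K x0] assms(1) by metis
  then interpret space_ball_plane K R x0 u1 u2 by unfold_locales
  show "\<mu> * hess K R \<le> L" "\<mu> \<le> L * hess K R"
    using smooth_convex_ratio[of F "rgrad K M F" L \<mu>] assms(2,3)
    unfolding smooth_fun_on_ball strongly_gconvex_on_ball hess_def by auto
qed

lemma hess_pos: "hess K R > 0"
  using R cs_R sn_R by (simp add: hess_def)

text \<open>The factor c of \<open>half_square_expansion\<close> lies between 1 and
  \<open>hess K R\<close>, which gives admissible constants for half the squared distance. They are
  extremal by \<open>smooth_convex_hess\<close> for this function (by
  \<open>convex_le_smooth\<close> where both constants are equal), and the same bounds for F compare
  the quotients.\<close>

lemma condition_number_le:
  assumes M: "B \<subseteq> M" "M \<subseteq> space_form K"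
    and F: "smooth_fun_on K M B F L" "strongly_gconvex_on K M B F \<mu>" "\<mu> > 0"
  shows "condition_number K M B (\<lambda>x. (rdist K x x0)\<^sup>2 / 2) \<le> L / \<mu>"
proof -
  define \<Phi> where "\<Phi> = (\<lambda>x. (rdist K x x0)\<^sup>2 / 2)"
  have rgrad: "rgrad K M \<Phi> x = - slog K x x0" if "x \<in> B" for x
    unfolding \<Phi>_def by (rule rgrad_half_square[OF M that])
  have \<Phi>: "\<Phi> x = (sdist K x x0)\<^sup>2 / 2" if "x \<in> B" for x
    using ball_rdist[OF that center_mem_ball] by (simp add: \<Phi>_def)
  have smooth: "smooth_fun_on K M B \<Phi> l"
    if l: "\<And>c. K * (1 - c) \<ge> 0 \<Longrightarrow> K * (c - hess K R) \<ge> 0 \<Longrightarrow> (DIM('a) = 1 \<Longrightarrow> c = 1) \<Longrightarrow> c \<le> l" for l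
    unfolding smooth_fun_on_ball
  proof (intro ballI)
    fix x y assume xy: "x \<in> B" "y \<in> B"
    obtain c where c: "(sdist K y x0)\<^sup>2 / 2 = (sdist K x x0)\<^sup>2 / 2 + form K (- slog K x x0) (slog K x y) + c / 2 * (sdist K x y)\<^sup>2"
      "K * (1 - c) \<ge> 0" "K * (c - hess K R) \<ge> 0" "DIM('a) = 1 \<Longrightarrow> c = 1"
      using half_square_expansion[OF xy] by blast
    have "c / 2 * (sdist K x y)\<^sup>2 \<le> l / 2 * (sdist K x y)\<^sup>2"
      using l[OF c(2-4)] by (intro mult_right_mono) auto
    then show "\<Phi> y \<le> \<Phi> x + form K (rgrad K M \<Phi> x) (slog K x y) + l / 2 * (sdist K x y)\<^sup>2"
      using c(1) by (simp add: \<Phi> xy rgrad)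
  qed
  have convex: "strongly_gconvex_on K M B \<Phi> l"
    if l: "\<And>c. K * (1 - c) \<ge> 0 \<Longrightarrow> K * (c - hess K R) \<ge> 0 \<Longrightarrow> (DIM('a) = 1 \<Longrightarrow> c = 1) \<Longrightarrow> l \<le> c" for l
    unfolding strongly_gconvex_on_ball
  proof (intro ballI)
    fix x y assume xy: "x \<in> B" "y \<in> B"
    obtain c where c: "(sdist K y x0)\<^sup>2 / 2 = (sdist K x x0)\<^sup>2 / 2 + form K (- slog K x x0) (slog K x y) + c / 2 * (sdist K x y)\<^sup>2"
      "K * (1 - c) \<ge> 0" "K * (c - hess K R) \<ge> 0" "DIM('a) = 1 \<Longrightarrow> c = 1"
      using half_square_expansion[OF xy] by blast
    have "l / 2 * (sdist K x y)\<^sup>2 \<le> c / 2 * (sdist K x y)\<^sup>2"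
      using l[OF c(2-4)] by (intro mult_right_mono) auto
    then show "\<Phi> y \<ge> \<Phi> x + form K (rgrad K M \<Phi> x) (slog K x y) + l / 2 * (sdist K x y)\<^sup>2"
      using c(1) by (simp add: \<Phi> xy rgrad)
  qed
  have cond: "condition_number K M B \<Phi> = l / m"
    if "smooth_fun_on K M B \<Phi> l" "strongly_gconvex_on K M B \<Phi> m"
      "\<And>l'. smooth_fun_on K M B \<Phi> l' \<Longrightarrow> l \<le> l'" "\<And>m'. strongly_gconvex_on K M B \<Phi> m' \<Longrightarrow> m' \<le> m" for l m
    using Least_equality[of "smooth_fun_on K M B \<Phi>" l] Greatest_equality[of "strongly_gconvex_on K M B \<Phi>" m] that
    by (simp add: condition_number_def)
  have "condition_number K M B \<Phi> \<le> L / \<mu>"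
  proof (cases "DIM('a) = 1")
    case True
    have "smooth_fun_on K M B \<Phi> 1" "strongly_gconvex_on K M B \<Phi> 1"
      by (rule smooth convex; use True in simp)+
    then have "condition_number K M B \<Phi> = 1 / 1"
      using convex_le_smooth by (intro cond) auto
    then show ?thesis using convex_le_smooth[OF F(1,2)] F(3) by simp
  next
    case False
    then have dim: "DIM('a) \<ge> 2" using DIM_positive[where 'a = 'a] by linarith
    show ?thesis
    proof (cases "K > 0")
      case True
      have 1: "smooth_fun_on K M B \<Phi> 1" "strongly_gconvex_on K M B \<Phi> (hess K R)"
        by (rule smooth convex; use True in \<open>simp add: zero_le_mult_iff\<close>)+
      \<comment> \<open>The polygon bound with smoothness constant 1 limits the convexity constants.
        Used below with convexity constant \<open>hess K R\<close>, it shows that no smoothness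
        constant is less than 1.\<close>
      have "m' \<le> hess K R" if "strongly_gconvex_on K M B \<Phi> m'" for m'
        using smooth_convex_hess(2)[OF dim 1(1) that] by simp
      then have "condition_number K M B \<Phi> = 1 / hess K R"
        using convex_le_smooth 1 smooth_convex_hess(2)[OF dim _ 1(2)] hess_pos by (intro cond) auto
      show ?thesis unfolding \<open>condition_number K M B \<Phi> = 1 / hess K R\<close> using smooth_convex_hess(2)[OF dim F(1,2)] F(3) hess_pos by (simp add: field_simps)
    next
      case False
      then have "K < 0" using K by simp
      then have 1: "smooth_fun_on K M B \<Phi> (hess K R)" "strongly_gconvex_on K M B \<Phi> 1"
        by (auto intro!: smooth convex simp: zero_le_mult_iff)
      have "hess K R \<le> l'" if "smooth_fun_on K M B \<Phi> l'" for l'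
        using smooth_convex_hess(1)[OF dim that 1(2)] by simp
      moreover have "m' \<le> 1" if "strongly_gconvex_on K M B \<Phi> m'" for m'
        using smooth_convex_hess(1)[OF dim 1(1) that] hess_pos by simp
      ultimately have "condition_number K M B \<Phi> = hess K R / 1" using 1 by (intro cond) auto
      then show ?thesis using smooth_convex_hess(1)[OF dim F(1,2)] F(3) by (simp add: field_simps)
    qed
  qed
  then show ?thesis by (simp add: \<Phi>_def)
qed

end

theorem proposition29:
  fixes K R L \<mu> :: real
    and x0 :: "'a::euclidean_space \<times> real"
    and M :: "('a \<times> real) set"
    and F :: "'a \<times> real \<Rightarrow> real"
  assumes "K \<noteq> 0" and "R > 0" and "K > 0 \<Longrightarrow> R < pi / (2 * sqrt K)"
    and "x0 \<in> space_form K"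
    and "M \<subseteq> space_form K" and "manifold_subset M" and "geo_ball K x0 R \<subseteq> M"
    and "twice_differentiable_continuous_hessian K M F"
    and "smooth_fun_on K M (geo_ball K x0 R) F L"
    and "strongly_gconvex_on K M (geo_ball K x0 R) F \<mu>" and "\<mu> > 0"
  shows "L / \<mu> \<ge> condition_number K M (geo_ball K x0 R) (\<lambda>x. (rdist K x x0)\<^sup>2 / 2)"
proof -
  interpret space_ball K R x0 using assms by unfold_locales auto
  show ?thesis using condition_number_le assms by blast
qed

end
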